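(* There exist a sequence $\{F_n\}_{n\ge0}$ of holomorphic automorphisms of $\mathbb{C}^2$, each having an attracting fixed point at the origin, such that the non-autonomous basin of attraction \[ \Omega_{\{F_n\}}=\{z\in\mathbb{C}^2 : F_n\circ\cdots\circ F_0(z)\to0 \text{ as } n\to\infty\} \] is a Short $\mathbb{C}^2$ whose boundary is $C^\infty$-smooth.
   Context: A Short $\mathbb{C}^2$ is a domain $\Omega\subset\mathbb{C}^2$ such that: (1) $\Omega=\bigcup_{j\ge1}\Omega_j$ with $\Omega_j\subset\Omega_{j+1}$ and each $\Omega_j$ biholomorphic to the unit ball of $\mathbb{C}^2$; (2) the infinitesimal Kobayashi pseudometric of $\Omega$ vanishes identically; (3) $\Omega$ carries a non-constant plurisubharmonic function that is bounded above. *)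

theory Defs
  imports "HOL-Analysis.Analysis"
begin

text \<open>We model C^2 as the type complex \<times> complex; its norm is the Euclidean norm
  sqrt(|z1|^2 + |z2|^2), so ball 0 1 is the unit ball of C^2.\<close>

type_synonym C2 = "complex \<times> complex"

definition cmul :: "complex \<Rightarrow> C2 \<Rightarrow> C2" where
  "cmul c z = (c * fst z, c * snd z)"

definition hol2 :: "(C2 \<Rightarrow> C2) \<Rightarrow> C2 set \<Rightarrow> bool" where
  "hol2 F U \<longleftrightarrow> (\<forall>z\<in>U. \<exists>L. (F has_derivative L) (at z) \<and>
       (\<forall>c v. L (cmul c v) = cmul c (L v)))"

definition holomorphic_automorphism :: "(C2 \<Rightarrow> C2) \<Rightarrow> bool" where
  "holomorphic_automorphism F \<longleftrightarrow> bij F \<and> hol2 F UNIV \<and> hol2 (inv F) UNIV"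

definition attracting_fixed_point_at_0 :: "(C2 \<Rightarrow> C2) \<Rightarrow> bool" where
  "attracting_fixed_point_at_0 F \<longleftrightarrow> F 0 = 0 \<and>
     (\<forall>e v. v \<noteq> 0 \<and> frechet_derivative F (at 0) v = cmul e v \<longrightarrow> cmod e < 1)"

primrec comp_seq :: "(nat \<Rightarrow> C2 \<Rightarrow> C2) \<Rightarrow> nat \<Rightarrow> C2 \<Rightarrow> C2" where
  "comp_seq F 0 = F 0"
| "comp_seq F (Suc n) = F (Suc n) \<circ> comp_seq F n"

definition nonautonomous_basin :: "(nat \<Rightarrow> C2 \<Rightarrow> C2) \<Rightarrow> C2 set" where
  "nonautonomous_basin F = {z. (\<lambda>n. comp_seq F n z) \<longlonglongrightarrow> 0}"

definition biholomorphic_to_ball :: "C2 set \<Rightarrow> bool" where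
  "biholomorphic_to_ball W \<longleftrightarrow> open W \<and> (\<exists>\<phi>. hol2 \<phi> (ball 0 1) \<and> inj_on \<phi> (ball 0 1) \<and>
       \<phi> ` ball 0 1 = W \<and> hol2 (inv_into (ball 0 1) \<phi>) W)"

definition hol_disc :: "(complex \<Rightarrow> C2) \<Rightarrow> bool" where
  "hol_disc f \<longleftrightarrow> (\<lambda>\<zeta>. fst (f \<zeta>)) holomorphic_on ball 0 1 \<and> (\<lambda>\<zeta>. snd (f \<zeta>)) holomorphic_on ball 0 1"

definition kobayashi :: "C2 set \<Rightarrow> C2 \<Rightarrow> C2 \<Rightarrow> real" where
  "kobayashi \<Omega> z v = Inf {a::real. a > 0 \<and> (\<exists>f. hol_disc f \<and> f ` ball 0 1 \<subseteq> \<Omega> \<and> f 0 = z \<and>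
       (deriv (\<lambda>\<zeta>. fst (f \<zeta>)) 0, deriv (\<lambda>\<zeta>. snd (f \<zeta>)) 0) = cmul (complex_of_real (1 / a)) v)}"

text \<open>Plurisubharmonic functions with values in [-\<infinity>, \<infinity>): upper semicontinuous, and
  sub-mean value property on every closed complex disc a + \<zeta> b, |\<zeta>| \<le> 1, in \<Omega>:
  u(a) \<le> (1/2\<pi>) \<integral>_0^{2\<pi>} u(a + e^{i\<theta>} b) d\<theta>.  Since u may take the value -\<infinity>, the mean
  is expressed through the nonnegative integral of M - u for any real upper bound M.\<close>
definition usc_on :: "C2 set \<Rightarrow> (C2 \<Rightarrow> ereal) \<Rightarrow> bool" where
  "usc_on \<Omega> u \<longleftrightarrow> (\<forall>z\<in>\<Omega>. \<forall>c. u z < c \<longrightarrow> (\<forall>\<^sub>F w in at z. u w < c))"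

definition circle_sub_mean :: "(C2 \<Rightarrow> ereal) \<Rightarrow> C2 \<Rightarrow> C2 \<Rightarrow> bool" where
  "circle_sub_mean u a b \<longleftrightarrow> (\<forall>M::real. (\<forall>\<theta>. u (a + cmul (cis \<theta>) b) \<le> ereal M) \<longrightarrow>
      u a \<le> ereal M - enn2ereal ((\<integral>\<^sup>+ \<theta>\<in>{0..2*pi}. e2ennreal (ereal M - u (a + cmul (cis \<theta>) b)) \<partial>lborel)
                                   / ennreal (2*pi)))"

definition plurisubharmonic :: "(C2 \<Rightarrow> ereal) \<Rightarrow> C2 set \<Rightarrow> bool" where
  "plurisubharmonic u \<Omega> \<longleftrightarrow> (\<forall>z\<in>\<Omega>. u z \<noteq> \<infinity>) \<and> usc_on \<Omega> u \<and>
     (\<forall>a b. {a + cmul \<zeta> b | \<zeta>. cmod \<zeta> \<le> 1} \<subseteq> \<Omega> \<longrightarrow> circle_sub_mean u a b)"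

definition short_C2 :: "C2 set \<Rightarrow> bool" where
  "short_C2 \<Omega> \<longleftrightarrow> open \<Omega> \<and> connected \<Omega> \<and>
     (\<exists>W::nat \<Rightarrow> C2 set. (\<forall>j. W j \<subseteq> W (Suc j)) \<and> \<Omega> = (\<Union>j. W j) \<and> (\<forall>j. biholomorphic_to_ball (W j))) \<and>
     (\<forall>z\<in>\<Omega>. \<forall>v. kobayashi \<Omega> z v = 0) \<and>
     (\<exists>u. plurisubharmonic u \<Omega> \<and> (\<exists>M::real. \<forall>z\<in>\<Omega>. u z \<le> ereal M) \<and> (\<exists>z\<in>\<Omega>. \<exists>w\<in>\<Omega>. u z \<noteq> u w))"

fun Ck_on :: "nat \<Rightarrow> (C2 \<Rightarrow> real) \<Rightarrow> C2 set \<Rightarrow> bool" where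
  "Ck_on 0 f U = continuous_on U f"
| "Ck_on (Suc k) f U = ((\<forall>z\<in>U. f differentiable (at z)) \<and>
      (\<forall>v. Ck_on k (\<lambda>z. frechet_derivative f (at z) v) U))"

definition smooth_boundary :: "C2 set \<Rightarrow> bool" where
  "smooth_boundary \<Omega> \<longleftrightarrow> (\<forall>p\<in>frontier \<Omega>. \<exists>U \<rho>. open U \<and> p \<in> U \<and> (\<forall>k. Ck_on k \<rho> U) \<and>
      \<Omega> \<inter> U = {z\<in>U. \<rho> z < 0} \<and> (\<forall>z\<in>U. frechet_derivative \<rho> (at z) \<noteq> (\<lambda>_. 0)))"

end

theory Submission
  imports Defs "HOL-Complex_Analysis.Complex_Analysis"
begin

text \<open>
  Take the Henon maps \<open>F n (z, w) = (z\<^sup>2 + a n * w, z)\<close> with \<open>0 < a n \<le> 1/16\<close>. The first coordinates of the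
  compositions are polynomials \<open>P n\<close> with \<open>P (n + 2) = (P (n + 1))\<^sup>2 + a n * P n\<close>. For all such
  coefficients the basin is an increasing union of preimages of the ball under automorphisms of \<open>\<complex>\<^sup>2\<close>, and
  pulling back affine discs shows that its Kobayashi metric vanishes, since the derivatives of the
  compositions tend to \<open>0\<close> on the basin.

  If the \<open>a n\<close> decrease fast enough, then \<open>P (n + 1)\<close> is nearly \<open>(P n)\<^sup>2\<close> on the ball of radius \<open>n\<close>, so
  that \<open>ln (cmod (P n) + (1/8) ^ 2 ^ n) / 2 ^ n\<close> converges locally uniformly to a continuous
  plurisubharmonic function, which is \<open>\<le> 0\<close> on the basin and not constant. Near a boundary point the
  functions \<open>ln (cmod (P n)) / 2 ^ n\<close> are real parts of holomorphic functions and converge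
  uniformly; their limit is a defining function, and it is submersive because each \<open>a n\<close> is chosen after
  \<open>P n\<close> and \<open>P (n + 1)\<close> so small that the logarithmic derivative of \<open>P (n + 2)\<close> is almost twice that of \<open>P (n + 1)\<close>.
\<close>

subsection \<open>Automorphisms of the plane and the Kobayashi metric\<close>


text \<open>With all \<open>a n = 0\<close> the recursion would be exact squaring: for
  \<open>n >= 1\<close>, \<open>P n\<close> would be a power of the first coordinate, and the basin
  would be the unit disc times the complex plane. Those maps are not invertible, so positive
  coefficients perturb this model. The obstacle is the zero sets of the \<open>P n\<close>: there
  the logarithm and its derivative degenerate, and absolute closeness to a square gives no relative
  closeness. The derivative is therefore controlled only where \<open>cmod (P n)\<close> exceeds
  \<open>2 * (1/4) ^ 2 ^ n\<close>. Squaring respects such a threshold, so a neighbourhood on which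
  \<open>cmod (P N)\<close> is at least 1/2 stays above it at all later stages. Bounds for
  \<open>P n\<close> on a ball come from compactness alone, so the coefficients are found
  recursively and have no closed formula; since the balls grow, every compact set is eventually
  controlled. Gradients never vanish because consecutive ones stay linearly independent. The
  relative loss \<open>(1/2) ^ Suc n\<close> allowed at stage \<open>n\<close> is summable, so the
  normalised logarithmic gradient keeps a positive lower bound in the limit.\<close>

lemma hol2_compose:
  assumes "hol2 F UNIV" "hol2 G UNIV"
  shows "hol2 (F \<circ> G) UNIV"
  unfolding hol2_def
proof
  fix z
  obtain L where L: "(G has_derivative L) (at z)" "\<And>c v. L (cmul c v) = cmul c (L v)"
    using assms(2) unfolding hol2_def by blast
  obtain K where K: "(F has_derivative K) (at (G z))" "\<And>c v. K (cmul c v) = cmul c (K v)"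
    using assms(1) unfolding hol2_def by blast
  show "\<exists>L. (F \<circ> G has_derivative L) (at z) \<and> (\<forall>c v. L (cmul c v) = cmul c (L v))"
    using diff_chain_at[OF L(1) K(1)] L(2) K(2) by (intro exI[of _ "K \<circ> L"]) auto
qed

lemma holomorphic_automorphism_compose:
  assumes "holomorphic_automorphism F" "holomorphic_automorphism G"
  shows "holomorphic_automorphism (F \<circ> G)"
  using assms unfolding holomorphic_automorphism_def
  by (auto simp: bij_comp o_inv_distrib intro: hol2_compose)

definition henon :: "complex \<Rightarrow> C2 \<Rightarrow> C2" where
  "henon a q = ((fst q)\<^sup>2 + a * snd q, fst q)"

lemma henon_has_derivative:
  "(henon a has_derivative (\<lambda>h. (2 * fst q * fst h + a * snd h, fst h))) (at q)"
proof -
  have "henon a = (\<lambda>q. ((fst q)\<^sup>2 + a * snd q, fst q))" by (auto simp: henon_def)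
  then show ?thesis by (auto intro!: derivative_eq_intros)
qed

lemma henon_automorphism:
  assumes "a \<noteq> 0"
  shows "holomorphic_automorphism (henon a)"
proof -
  define K :: "C2 \<Rightarrow> C2" where "K = (\<lambda>q. (snd q, (fst q - (snd q)\<^sup>2) / a))"
  have 1: "henon a (K q) = q" "K (henon a q) = q" for q
    using assms by (auto simp: henon_def K_def)
  then have b: "bij (henon a)" by (metis bijI')
  have inv: "inv (henon a) = K" using 1 by (intro inv_equality) auto
  have K: "(K has_derivative (\<lambda>h. (snd h, (fst h - 2 * snd q * snd h) / a))) (at q)" for q
    unfolding K_def by (auto intro!: derivative_eq_intros simp: assms)
  have "hol2 (henon a) UNIV"
    unfolding hol2_def
    by (intro ballI exI conjI allI, rule henon_has_derivative) (simp add: cmul_def algebra_simps)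
  moreover have "hol2 K UNIV"
    unfolding hol2_def
    by (intro ballI exI conjI allI, rule K) (simp add: cmul_def diff_divide_distrib algebra_simps)
  ultimately show ?thesis using b inv by (simp add: holomorphic_automorphism_def)
qed

text \<open>The derivative at the origin squares to \<open>a\<close> times the identity, so every
  eigenvalue \<open>e\<close> satisfies \<open>e^2 = a\<close>.\<close>

lemma henon_attracting:
  assumes "cmod a < 1"
  shows "attracting_fixed_point_at_0 (henon a)"
proof -
  have fd: "frechet_derivative (henon a) (at 0) = (\<lambda>h. (a * snd h, fst h))"
    using frechet_derivative_at[OF henon_has_derivative[of a 0]] by simp
  have "cmod e < 1" if "v \<noteq> 0" "(a * snd v, fst v) = cmul e v" for e v
  proof -
    have e: "a * snd v = e * fst v" "fst v = e * snd v" using that by (auto simp: cmul_def)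
    then have "snd v \<noteq> 0" using that(1) by (auto simp: prod_eq_iff)
    moreover have "a * snd v = e\<^sup>2 * snd v" using e by (simp add: power2_eq_square)
    ultimately have "a = e\<^sup>2" by simp
    then have "(cmod e)\<^sup>2 < 1\<^sup>2" using assms by (simp add: norm_power)
    then show ?thesis using power2_less_imp_less by fastforce
  qed
  moreover have "henon a 0 = 0" by (simp add: henon_def zero_prod_def)
  ultimately show ?thesis
    unfolding attracting_fixed_point_at_0_def fd by blast
qed

section \<open>Discs, the Kobayashi metric and preimages of the ball\<close>

lemma hol2_line_derivative:
  assumes "(H has_derivative K) (at (q + cmul \<zeta> w))" "\<And>c v. K (cmul c v) = cmul c (K v)"
  shows "((\<lambda>\<zeta>. fst (H (q + cmul \<zeta> w))) has_field_derivative fst (K w)) (at \<zeta>)"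
    and "((\<lambda>\<zeta>. snd (H (q + cmul \<zeta> w))) has_field_derivative snd (K w)) (at \<zeta>)"
proof -
  have "((\<lambda>\<zeta>. q + cmul \<zeta> w) has_derivative (\<lambda>h. cmul h w)) (at \<zeta>)"
    unfolding cmul_def by (auto intro!: derivative_eq_intros simp: zero_prod_def)
  from diff_chain_at[OF this assms(1)]
  have *: "((\<lambda>\<zeta>. H (q + cmul \<zeta> w)) has_derivative (\<lambda>h. cmul h (K w))) (at \<zeta>)"
    by (simp add: o_def assms(2))
  show "((\<lambda>\<zeta>. fst (H (q + cmul \<zeta> w))) has_field_derivative fst (K w)) (at \<zeta>)"
    using has_derivative_fst[OF *]
    by (simp add: has_field_derivative_def cmul_def mult.commute[of _ "fst (K w)"])
  show "((\<lambda>\<zeta>. snd (H (q + cmul \<zeta> w))) has_field_derivative snd (K w)) (at \<zeta>)"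
    using has_derivative_snd[OF *]
    by (simp add: has_field_derivative_def cmul_def mult.commute[of _ "snd (K w)"])
qed

lemma norm_cmul: "norm (cmul c v) = cmod c * norm v"
proof -
  have "(norm (cmul c v))\<^sup>2 = (cmod c * norm v)\<^sup>2"
    by (simp add: cmul_def norm_prod_def norm_mult power_mult_distrib algebra_simps)
  then show ?thesis by (simp add: power2_eq_iff_nonneg)
qed

lemma cmul_cmul: "cmul a (cmul b v) = cmul (a * b) v"
  by (simp add: cmul_def mult.assoc)

text \<open>Since \<open>H z\<close> has norm below 1/2, an affine disc through \<open>H z\<close>
  with direction of norm below 1/2 stays in the unit ball. If \<open>L v\<close> is shorter than
  \<open>e/2\<close>, the direction \<open>L v / e\<close> is admissible, and \<open>inv H\<close>
  carries this disc to one in \<Omega> with tangent vector \<open>v / e\<close>. Hence every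
  positive number competes in the infimum.\<close>

lemma kobayashi_eq_0I:
  assumes "\<And>r. r > 0 \<Longrightarrow> \<exists>H L. holomorphic_automorphism H \<and> H -` ball 0 1 \<subseteq> \<Omega> \<and>
      (H has_derivative L) (at z) \<and> norm (H z) < 1/2 \<and> norm (L v) < r"
  shows "kobayashi \<Omega> z v = 0"
proof -
  define S where "S = {a::real. a > 0 \<and> (\<exists>f. hol_disc f \<and> f ` ball 0 1 \<subseteq> \<Omega> \<and> f 0 = z \<and>
       (deriv (\<lambda>\<zeta>. fst (f \<zeta>)) 0, deriv (\<lambda>\<zeta>. snd (f \<zeta>)) 0) = cmul (complex_of_real (1 / a)) v)}"
  have S: "e \<in> S" if e: "e > 0" for e
  proof -
    obtain H L where H: "holomorphic_automorphism H" "H -` ball 0 1 \<subseteq> \<Omega>"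
      "(H has_derivative L) (at z)" "norm (H z) < 1/2" "norm (L v) < e/2"
      using assms[of "e/2"] e by auto
    have bH: "bij H" using H(1) by (simp add: holomorphic_automorphism_def)
    define w where "w = cmul (complex_of_real (1/e)) (L v)"
    have nw: "norm w < 1/2"
      using H(5) e by (simp add: w_def norm_cmul field_simps norm_divide)
    define f where "f = (\<lambda>\<zeta>. inv H (H z + cmul \<zeta> w))"
    have hK: "\<exists>K. (inv H has_derivative K) (at y) \<and> (\<forall>c v. K (cmul c v) = cmul c (K v))" for y
      using H(1) unfolding holomorphic_automorphism_def hol2_def by blast
    have hd: "hol_disc f"
      unfolding hol_disc_def f_def holomorphic_on_def
      using hK hol2_line_derivative by (meson field_differentiable_at_within field_differentiable_def)
    have im: "f ` ball 0 1 \<subseteq> \<Omega>"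
    proof (rule image_subsetI)
      fix \<zeta> :: complex assume "\<zeta> \<in> ball 0 1"
      then have "cmod \<zeta> \<le> 1" by auto
      then have "cmod \<zeta> * norm w \<le> norm w" by (simp add: mult_left_le_one_le)
      then have "norm (H z + cmul \<zeta> w) < 1"
        using norm_triangle_ineq[of "H z" "cmul \<zeta> w"] H(4) nw by (simp add: norm_cmul)
      moreover have "H (f \<zeta>) = H z + cmul \<zeta> w"
        by (simp add: f_def bH bij_is_surj surj_f_inv_f)
      ultimately show "f \<zeta> \<in> \<Omega>" using H(2) by auto
    qed
    have c0: "H z + cmul 0 w = H z" by (simp add: cmul_def zero_prod_def[symmetric])
    have f0: "f 0 = z" by (simp add: f_def c0 bH bij_is_inj)
    obtain K where K: "(inv H has_derivative K) (at (H z))" "\<And>c v. K (cmul c v) = cmul c (K v)"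
      using hK by blast
    \<comment> \<open>The chain rule makes \<open>K\<close> a left inverse of \<open>L\<close>,
      which turns the direction \<open>L v / e\<close> back into \<open>v / e\<close>.\<close>
    have "inv H \<circ> H = id" using bH by (simp add: bij_is_inj)
    then have "K \<circ> L = id"
      using diff_chain_at[OF H(3) K(1)] has_derivative_id has_derivative_unique by metis
    then have "K (L v) = v" by (metis comp_apply id_apply)
    then have "K w = cmul (complex_of_real (1/e)) v" by (simp add: w_def K(2))
    moreover have "deriv (\<lambda>\<zeta>. fst (f \<zeta>)) 0 = fst (K w)" "deriv (\<lambda>\<zeta>. snd (f \<zeta>)) 0 = snd (K w)"
      unfolding f_def using hol2_line_derivative[of "inv H" K "H z" 0 w] K c0
      by (auto intro!: DERIV_imp_deriv)
    ultimately show ?thesis unfolding S_def using e hd im f0 by (auto intro!: exI[of _ f])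
  qed
  then have "S = {0<..}" unfolding S_def by auto
  then show ?thesis unfolding kobayashi_def S_def[symmetric] by simp
qed

lemma biholomorphic_to_ball_vimage:
  assumes H: "holomorphic_automorphism H"
  shows "biholomorphic_to_ball (H -` ball 0 1)"
proof -
  have bH: "bij H" and h: "hol2 H UNIV" "hol2 (inv H) UNIV"
    using H by (auto simp: holomorphic_automorphism_def)
  have "continuous_on UNIV H"
    using h(1) unfolding hol2_def by (meson continuous_at_imp_continuous_on has_derivative_continuous)
  then have op: "open (H -` ball 0 1)" using open_vimage by blast
  have im: "inv H ` ball 0 1 = H -` ball 0 1"
    using bH by (simp add: bij_vimage_eq_inv_image)
  have inj: "inj_on (inv H) (ball 0 1)"
    using bH by (meson bij_betw_def bij_betw_inv_into inj_on_subset subset_UNIV)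
  have eq: "inv_into (ball 0 1) (inv H) q = H q" if "q \<in> H -` ball 0 1" for q
    using inv_into_f_f[OF inj, of "H q"] that bH by (simp add: bij_is_inj)
  have "hol2 (inv_into (ball 0 1) (inv H)) (H -` ball 0 1)"
    unfolding hol2_def
  proof
    fix q assume q: "q \<in> H -` ball 0 1"
    obtain L where L: "(H has_derivative L) (at q)" "\<And>c v. L (cmul c v) = cmul c (L v)"
      using h(1) unfolding hol2_def by blast
    \<comment> \<open>\<open>inv_into\<close> agrees with \<open>H\<close> on the preimage of the
      ball, which is open, so the derivative of \<open>H\<close> carries over.\<close>
    have "(inv_into (ball 0 1) (inv H) has_derivative L) (at q)"
      by (rule has_derivative_transform_within_open[OF L(1) op q]) (simp add: eq)
    then show "\<exists>L. (inv_into (ball 0 1) (inv H) has_derivative L) (at q) \<and> (\<forall>c v. L (cmul c v) = cmul c (L v))"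
      using L(2) by blast
  qed
  moreover have "hol2 (inv H) (ball 0 1)" using h(2) unfolding hol2_def by blast
  ultimately show ?thesis
    unfolding biholomorphic_to_ball_def using op im inj by blast
qed

lemma connected_vimage_ball_automorphism:
  assumes H: "holomorphic_automorphism H"
  shows "connected (H -` ball 0 1)"
proof -
  have bH: "bij H" and h: "hol2 (inv H) UNIV"
    using H by (auto simp: holomorphic_automorphism_def)
  have "continuous_on UNIV (inv H)"
    using h unfolding hol2_def by (meson continuous_at_imp_continuous_on has_derivative_continuous)
  then have "connected (inv H ` ball 0 1)"
    by (meson connected_ball connected_continuous_image continuous_on_subset subset_UNIV)
  then show ?thesis using bH by (simp add: bij_vimage_eq_inv_image)
qed

subsection \<open>Sub-mean values of logarithms\<close>


text \<open>Maximum principle for the product of \<open>g (\<zeta> * \<omega>) + \<eta> * e\<close> over the \<open>N\<close>-th roots of unity \<open>\<omega>\<close>, the unimodular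
  \<open>e\<close> being aligned with \<open>g 0\<close>. As \<open>N\<close> grows the right-hand side becomes a Riemann sum for the logarithmic
  mean, so the sub-mean property follows without Jensen's formula.\<close>

lemma maximum_principle_rotation_product:
  fixes g :: "complex \<Rightarrow> complex"
  fixes N :: nat
  assumes g: "g holomorphic_on ball 0 1" "continuous_on (cball 0 1) g" and "\<eta> \<ge> 0"
  shows "\<exists>t\<in>{0..2*pi}. (cmod (g 0) + \<eta>) ^ N \<le> (\<Prod>k<N. cmod (g (cis (t + 2*pi*real k/real N))) + \<eta>)"
proof -
  define e where "e = (if g 0 = 0 then 1 else sgn (g 0))"
  have e1: "cmod e = 1" by (simp add: e_def norm_sgn)
  have "g 0 + of_real \<eta> * e = of_real (cmod (g 0) + \<eta>) * e"
    by (simp add: e_def algebra_simps sgn_eq)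
  then have e2: "cmod (g 0 + of_real \<eta> * e) = cmod (g 0) + \<eta>"
    using e1 assms(3) by (simp add: norm_mult del: of_real_add)
  define K where "K = (\<lambda>\<zeta>. \<Prod>k<N. g (\<zeta> * cis (2*pi*real k/real N)) + of_real \<eta> * e)"
  define \<psi> where "\<psi> = (\<lambda>t. \<Prod>k<N. cmod (g (cis (t + 2*pi*real k/real N))) + \<eta>)"
  have gc: "continuous_on S (\<lambda>t. g (f t))" if "continuous_on S f" "\<And>t. t \<in> S \<Longrightarrow> cmod (f t) \<le> 1" for S and f :: "'b::topological_space \<Rightarrow> complex"
    using that by (intro continuous_on_compose2[OF g(2)]) auto
  have "continuous_on {0..2*pi} \<psi>"
    unfolding \<psi>_def by (intro continuous_intros gc) auto
  then obtain t where t: "t \<in> {0..2*pi}" "\<And>s. s \<in> {0..2*pi} \<Longrightarrow> \<psi> s \<le> \<psi> t"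
    using continuous_attains_sup[of "{0..2*pi}" \<psi>] by fastforce
  have gh: "(\<lambda>\<zeta>. g (\<zeta> * cis c)) holomorphic_on ball 0 1" for c
  proof -
    have "(\<lambda>\<zeta>. \<zeta> * cis c) ` ball 0 1 \<subseteq> ball 0 1" by (auto simp: norm_mult)
    moreover have "(\<lambda>\<zeta>. \<zeta> * cis c) holomorphic_on ball 0 1" by (intro holomorphic_intros)
    ultimately show ?thesis using holomorphic_on_compose_gen[OF _ g(1)] unfolding o_def by blast
  qed
  have "cmod (K 0) \<le> \<psi> t"
  proof (rule maximum_modulus_frontier[of K "cball 0 1"])
    show "K holomorphic_on interior (cball 0 1)"
      unfolding K_def by (auto intro!: holomorphic_intros gh)
    show "continuous_on (closure (cball 0 1)) K"
      unfolding K_def by (auto intro!: continuous_intros gc simp: norm_mult)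
    fix z :: complex assume "z \<in> frontier (cball 0 1)"
    then have z: "z = cis (Arg2pi z)" using complex_norm_eq_1_exp[of z] by (simp add: cis_conv_exp)
    have "Arg2pi z \<in> {0..2*pi}" using Arg2pi by (auto intro: less_imp_le)
    then have "\<psi> (Arg2pi z) \<le> \<psi> t" by (rule t(2))
    moreover have "cmod (K z) \<le> \<psi> (Arg2pi z)"
      unfolding K_def \<psi>_def prod_norm[symmetric]
    proof (intro prod_mono conjI)
      fix k
      have "z * cis (2*pi*real k/real N) = cis (Arg2pi z + 2*pi*real k/real N)" 
        by (subst (1) z) (simp only: cis_mult)
      then show "cmod (g (z * cis (2*pi*real k/real N)) + of_real \<eta> * e) \<le> cmod (g (cis (Arg2pi z + 2*pi*real k/real N))) + \<eta>"
        using norm_triangle_ineq[of "g (z * cis (2*pi*real k/real N))" "of_real \<eta> * e"] e1 assms(3)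
        by (simp add: norm_mult)
    qed auto
    ultimately show "cmod (K z) \<le> \<psi> t" by simp
  qed auto
  \<comment> \<open>At the centre the rotations disappear and all \<open>N\<close> factors
    coincide.\<close>
  moreover have "cmod (K 0) = (cmod (g 0) + \<eta>) ^ N"
    by (simp add: K_def norm_power e2)
  ultimately show ?thesis using t(1) by (auto simp: \<psi>_def)
qed

section \<open>Riemann sums of periodic functions\<close>

lemma integral_shift_period:
  fixes h :: "real \<Rightarrow> real"
  assumes h: "continuous_on UNIV h" and per: "\<And>x. h (x + p) = h x" and t: "t \<in> {0..p}"
  shows "integral {t..t+p} h = integral {0..p} h"
proof -
  have int: "h integrable_on {a..b}" for a b
    by (intro integrable_continuous_interval continuous_on_subset[OF h]) auto
  have "integral {t..t+p} h = integral {t..p} h + integral {p..t+p} h"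
    using t int by (intro Henstock_Kurzweil_Integration.integral_combine[symmetric]) auto
  also have "integral {p..t+p} h = integral {0..t} h"
  proof -
    have "integral {0..t} (\<lambda>x. h (x + p)) = integral {p..t+p} h"
      using integral_shift_Icc_real[of 0 t h p] by (simp add: o_def add.commute)
    then show ?thesis using per by simp
  qed
  also have "integral {t..p} h + integral {0..t} h = integral {0..p} h"
    using t int Henstock_Kurzweil_Integration.integral_combine[of 0 t p h] by auto
  finally show ?thesis .
qed

lemma integral_consecutive_sum:
  fixes h :: "real \<Rightarrow> real" and t d :: real
  assumes h: "continuous_on UNIV h" and "d \<ge> 0"
  shows "(\<Sum>k<n. integral {t + d * real k..t + d * real (Suc k)} h) = integral {t..t + d * real n} h"
proof (induction n)
  case (Suc n)
  have "integral {t..t + d * n} h + integral {t + d * n..t + d * Suc n} h = integral {t..t + d * Suc n} h"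
    using assms by (intro Henstock_Kurzweil_Integration.integral_combine integrable_continuous_interval
        continuous_on_subset[OF h]) (auto simp: algebra_simps)
  then show ?case using Suc by (simp add: algebra_simps)
qed simp

text \<open>The starting angle \<open>t\<close> may change with \<open>N\<close>, so the sums do not
  belong to one fixed sequence of partitions. Uniform continuity on an interval containing every
  window \<open>{t..t+2*pi}\<close> gives a Riemann sum error independent of \<open>t\<close>, and
  periodicity moves the window back to \<open>{0..2*pi}\<close>.\<close>

lemma integral_ge_if_equidistant_means_ge:
  fixes h :: "real \<Rightarrow> real" and x :: real
  assumes h: "continuous_on UNIV h" and per: "\<And>x. h (x + 2*pi) = h x"
    and le: "\<And>N::nat. N > 0 \<Longrightarrow> \<exists>t\<in>{0..2*pi}. real N * x \<le> (\<Sum>k<N. h (t + 2*pi*real k/real N))"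
  shows "2*pi*x \<le> integral {0..2*pi} h"
proof (rule field_le_epsilon)
  fix e' :: real assume e': "e' > 0"
  define e where "e = e' / (2*pi)"
  have e: "e > 0" using e' by (simp add: e_def)
  have "uniformly_continuous_on {0..6*pi} h"
    by (intro compact_uniformly_continuous continuous_on_subset[OF h]) auto
  then obtain \<delta> where \<delta>: "\<delta> > 0" "\<And>x y. x \<in> {0..6*pi} \<Longrightarrow> y \<in> {0..6*pi} \<Longrightarrow> dist y x < \<delta> \<Longrightarrow> dist (h y) (h x) < e"
    unfolding uniformly_continuous_on_def using e by metis
  obtain N :: nat where N: "N > 2*pi/\<delta>" using reals_Archimedean2 by blast
  have "2*pi/\<delta> > 0" using \<delta>(1) by simp
  then have N0: "N > 0" using N by (metis less_trans of_nat_0_less_iff)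
  define d where "d = 2*pi/N"
  have d: "d > 0" "d < \<delta>" "d * N = 2*pi" using N N0 \<delta>(1) by (auto simp: d_def field_simps)
  obtain t where t: "t \<in> {0..2*pi}" "real N * x \<le> (\<Sum>k<N. h (t + 2*pi*real k/real N))" using le N0 by blast
  have part: "d * h (t + 2*pi*real k/real N) \<le> integral {t + d * real k..t + d * real (Suc k)} h + d * e" if k: "k < N" for k
  proof -
    have tk: "t + 2*pi*real k/real N = t + d * k" by (simp add: d_def)
    have "d * Suc k \<le> d * N" using k d by (intro mult_left_mono) auto
    then have top: "t + d * Suc k \<le> 4*pi" using t(1) d(3) by auto
    have bot: "0 \<le> t + d * k" using t(1) d(1) by auto
    have "integral {t + d * real k..t + d * real (Suc k)} (\<lambda>s. h (t + d * k) - e) \<le> integral {t + d * real k..t + d * real (Suc k)} h"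
    proof (rule integral_le)
      fix s assume s: "s \<in> {t + d * k..t + d * Suc k}"
      then have "dist (t + d * k) s < \<delta>" using d by (auto simp: dist_real_def algebra_simps)
      moreover have "s \<in> {0..6*pi}" "t + d * k \<in> {0..6*pi}" using s top bot pi_gt_zero d(1)
        by (auto simp: algebra_simps intro: order_trans)
      ultimately have "dist (h (t + d * k)) (h s) < e" using \<delta>(2) by blast
      then show "h (t + d * k) - e \<le> h s" by (simp add: dist_real_def)
    qed (auto intro!: integrable_continuous_interval continuous_on_subset[OF h])
    moreover have "integral {t + d * real k..t + d * real (Suc k)} (\<lambda>s. h (t + d * k) - e) = d * (h (t + d * k) - e)"
    proof -
      have "t + d * real (Suc k) - (t + d * real k) = d" by (simp add: algebra_simps)
      moreover have "t + d * real k \<le> t + d * real (Suc k)" using d(1) by simp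
      ultimately show ?thesis using integral_const_real[of "t + d * real k" "t + d * real (Suc k)" "h (t + d * real k) - e"]
        by (simp only: measure_lborel_Icc real_scaleR_def)
    qed
    ultimately have "d * (h (t + d * real k) - e) \<le> integral {t + d * real k..t + d * real (Suc k)} h" by (simp only:)
    then show ?thesis unfolding tk by (simp only: right_diff_distrib)
  qed
  have "2*pi*x = d * (real N * x)" using d(3) by (metis mult.assoc)
  also have "\<dots> \<le> d * (\<Sum>k<N. h (t + 2*pi*real k/real N))" using t(2) d(1) by (intro mult_left_mono) auto
  also have "\<dots> \<le> (\<Sum>k<N. integral {t + d * real k..t + d * real (Suc k)} h + d * e)"
    unfolding sum_distrib_left by (intro sum_mono part) auto
  also have "\<dots> = integral {t..t + 2*pi} h + 2*pi*e"
  proof -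
    have "(\<Sum>k<N. d * e) = 2*pi*e" using d(3) by (simp add: mult.commute mult.left_commute)
    moreover have "(\<Sum>k<N. integral {t + d * real k..t + d * real (Suc k)} h) = integral {t..t + 2*pi} h"
      using integral_consecutive_sum[OF h less_imp_le[OF d(1)], of t N] unfolding d(3) .
    ultimately show ?thesis by (simp only: sum.distrib)
  qed
  also have "\<dots> = integral {0..2*pi} h + e'"
    using integral_shift_period[OF h per t(1)] by (simp add: e_def)
  finally show "2*pi*x \<le> integral {0..2*pi} h + e'" .
qed

text \<open>Taking logarithms turns the product bound for each \<open>N\<close> into a bound by an
  equidistant sum. The positive \<eta> keeps the integrand continuous at zeros of
  \<open>g\<close>.\<close>

lemma sub_mean_ln_norm_plus:
  fixes g :: "complex \<Rightarrow> complex"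
  assumes g: "g holomorphic_on ball 0 1" "continuous_on (cball 0 1) g" and \<eta>: "\<eta> > 0"
  shows "2*pi * ln (cmod (g 0) + \<eta>) \<le> integral {0..2*pi} (\<lambda>\<theta>. ln (cmod (g (cis \<theta>)) + \<eta>))"
proof (rule integral_ge_if_equidistant_means_ge)
  have pos: "cmod w + \<eta> > 0" for w using \<eta> by (simp add: add_nonneg_pos)
  have "continuous_on UNIV (\<lambda>\<theta>. g (cis \<theta>))"
    by (rule continuous_on_compose2[OF g(2)]) (auto intro!: continuous_intros)
  then show "continuous_on UNIV (\<lambda>\<theta>. ln (cmod (g (cis \<theta>)) + \<eta>))"
    using pos by (auto intro!: continuous_intros simp: less_imp_neq[symmetric])
  show "ln (cmod (g (cis (x + 2*pi))) + \<eta>) = ln (cmod (g (cis x)) + \<eta>)" for x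
    by (simp add: cis_mult[symmetric])
  fix N :: nat
  obtain t where t: "t\<in>{0..2*pi}" "(cmod (g 0) + \<eta>) ^ N \<le> (\<Prod>k<N. cmod (g (cis (t + 2*pi*real k/real N))) + \<eta>)"
    using maximum_principle_rotation_product[OF g, of \<eta> N] \<eta> by auto
  have "real N * ln (cmod (g 0) + \<eta>) = ln ((cmod (g 0) + \<eta>) ^ N)" using pos by (simp add: ln_realpow)
  also have "\<dots> \<le> ln (\<Prod>k<N. cmod (g (cis (t + 2*pi*real k/real N))) + \<eta>)"
    using t(2) pos by (intro ln_mono) (auto intro!: prod_pos)
  also have "\<dots> = (\<Sum>k<N. ln (cmod (g (cis (t + 2*pi*real k/real N))) + \<eta>))"
    by (rule ln_prod) (use pos in \<open>auto simp: less_imp_neq[symmetric]\<close>)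
  finally show "\<exists>t\<in>{0..2*pi}. real N * ln (cmod (g 0) + \<eta>) \<le> (\<Sum>k<N. ln (cmod (g (cis (t + 2*pi*real k/real N))) + \<eta>))"
    using t(1) by blast
qed

text \<open>For a continuous real function the nonnegative integral of \<open>M - U\<close> in the
  definition is \<open>2*pi*M\<close> minus the ordinary integral of \<open>U\<close>; this converts
  a real inequality into the extended-real one.\<close>

lemma circle_sub_mean_ereal:
  fixes U :: "C2 \<Rightarrow> real"
  assumes cont: "continuous_on UNIV (\<lambda>\<theta>. U (a + cmul (cis \<theta>) b))"
    and le: "2*pi * U a \<le> integral {0..2*pi} (\<lambda>\<theta>. U (a + cmul (cis \<theta>) b))"
  shows "circle_sub_mean (\<lambda>z. ereal (U z)) a b"
  unfolding circle_sub_mean_def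
proof (intro allI impI)
  fix M :: real
  define h where "h = (\<lambda>\<theta>. U (a + cmul (cis \<theta>) b))"
  assume "\<forall>\<theta>. ereal (U (a + cmul (cis \<theta>) b)) \<le> ereal M"
  then have M: "h \<theta> \<le> M" for \<theta> by (simp add: h_def)
  have hc: "continuous_on UNIV h" using cont by (simp add: h_def)
  then have hi: "h integrable_on {0..2*pi}"
    by (intro integrable_continuous_interval continuous_on_subset[OF hc]) auto
  define I where "I = 2*pi*M - integral {0..2*pi} h"
  have "((\<lambda>\<theta>. M - h \<theta>) has_integral I) {0..2*pi}"
    unfolding I_def using has_integral_diff[OF has_integral_const_real[of M 0 "2*pi"] integrable_integral[OF hi]]
    by simp
  then have "((\<lambda>\<theta>. if \<theta> \<in> {0..2*pi} then M - h \<theta> else 0) has_integral I) UNIV"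
    by (subst has_integral_restrict_UNIV)
  then have *: "((\<lambda>\<theta>. (M - h \<theta>) * indicator {0..2*pi} \<theta>) has_integral I) UNIV"
    by (rule has_integral_eq[rotated]) (auto simp: indicator_def)
  have I0: "I \<ge> 0" by (rule has_integral_nonneg[OF *]) (use M in \<open>auto simp: indicator_def\<close>)
  have [measurable]: "h \<in> borel_measurable borel" using hc by (rule borel_measurable_continuous_onI)
  have "(\<integral>\<^sup>+ \<theta>\<in>{0..2*pi}. e2ennreal (ereal M - ereal (h \<theta>)) \<partial>lborel)
      = (\<integral>\<^sup>+ \<theta>. ennreal ((M - h \<theta>) * indicator {0..2*pi} \<theta>) \<partial>lborel)"
    by (intro nn_integral_cong) (auto simp: indicator_def e2ennreal_ereal)
  also have "\<dots> = ennreal I"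
    by (rule nn_integral_has_integral_lborel[OF _ _ *]) (use M in \<open>auto simp: indicator_def\<close>)
  finally have eq: "(\<integral>\<^sup>+ \<theta>\<in>{0..2*pi}. e2ennreal (ereal M - ereal (h \<theta>)) \<partial>lborel) = ennreal I" .
  have "U a \<le> M - I / (2*pi)" using le by (simp add: I_def h_def field_simps)
  then have "ereal (U a) \<le> ereal M - enn2ereal (ennreal I / ennreal (2*pi))"
    using I0 by (simp add: divide_ennreal enn2ereal_ennreal)
  then show "ereal (U a) \<le> ereal M - enn2ereal ((\<integral>\<^sup>+ \<theta>\<in>{0..2*pi}. e2ennreal (ereal M - ereal (U (a + cmul (cis \<theta>) b))) \<partial>lborel)
                                   / ennreal (2*pi))"
    unfolding eq[unfolded h_def] .
qed

lemma usc_on_ereal: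
  assumes "continuous_on UNIV U"
  shows "usc_on \<Omega> (\<lambda>z. ereal (U z))"
  unfolding usc_on_def
proof (intro ballI allI impI)
  fix z c assume "ereal (U z) < c"
  moreover have "((\<lambda>w. ereal (U w)) \<longlongrightarrow> ereal (U z)) (at z)"
    using assms unfolding continuous_on_def by (intro tendsto_intros) blast
  ultimately show "\<forall>\<^sub>F w in at z. ereal (U w) < c" by (rule order_tendstoD(2)[rotated])
qed

lemma plurisubharmonic_uniform_limit:
  fixes U :: "C2 \<Rightarrow> real" and V :: "nat \<Rightarrow> C2 \<Rightarrow> real"
  assumes cont: "\<And>n. continuous_on UNIV (V n)"
    and lim: "\<And>R. uniform_limit (cball 0 R) V U sequentially"
    and sub: "\<And>n a b. 2*pi * V n a \<le> integral {0..2*pi} (\<lambda>\<theta>. V n (a + cmul (cis \<theta>) b))"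
  shows "plurisubharmonic (\<lambda>z. ereal (U z)) \<Omega>"
proof -
  have UR: "continuous_on (cball 0 R) U" for R
    by (rule uniform_limit_theorem[OF _ lim]) (auto intro!: always_eventually continuous_on_subset[OF cont])
  have "continuous_on UNIV U"
    unfolding continuous_on_eq_continuous_at[OF open_UNIV]
  proof
    fix z :: C2
    have "continuous_on (ball 0 (norm z + 1)) U" using UR continuous_on_subset ball_subset_cball by blast
    then show "isCont U z" by (rule continuous_on_interior) (simp add: interior_open)
  qed
  note U = this
  have circ: "continuous_on UNIV (\<lambda>\<theta>. f (a + cmul (cis \<theta>) b))" if "continuous_on UNIV f" for a b and f :: "C2 \<Rightarrow> real"
    by (rule continuous_on_compose2[OF that]) (auto simp: cmul_def intro!: continuous_intros)
  have "circle_sub_mean (\<lambda>z. ereal (U z)) a b" for a b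
  proof (rule circle_sub_mean_ereal[OF circ[OF U]], rule field_le_epsilon)
    fix e :: real assume e: "e > 0"
    \<comment> \<open>This ball contains the circle and its centre. The approximation error
      \<open>e / (4*pi)\<close> enters twice, at the centre and under the integral, and costs
      \<open>e/2\<close> each time.\<close>
    define R where "R = norm a + norm b"
    have R: "a \<in> cball 0 R" "a + cmul (cis \<theta>) b \<in> cball 0 R" for \<theta>
      using norm_triangle_ineq[of a "cmul (cis \<theta>) b"] by (auto simp: R_def norm_cmul)
    have "\<forall>\<^sub>F n in sequentially. \<forall>z\<in>cball 0 R. dist (V n z) (U z) < e / (4*pi)"
      by (rule uniform_limitD[OF lim]) (use e in simp)
    then obtain n where n: "\<And>z. z \<in> cball 0 R \<Longrightarrow> dist (V n z) (U z) < e / (4*pi)"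
      using eventually_happens'[OF sequentially_bot] by blast
    have n': "\<bar>V n z - U z\<bar> < e / (4*pi)" if "z \<in> cball 0 R" for z using n[OF that] by (simp add: dist_real_def)
    have "U a \<le> V n a + e / (4*pi)" using n'[OF R(1)] by simp
    then have "2*pi * U a \<le> 2*pi * (V n a + e / (4*pi))" by (intro mult_left_mono) auto
    also have "\<dots> = 2*pi * V n a + e / 2" by (simp add: field_simps)
    also have "\<dots> \<le> integral {0..2*pi} (\<lambda>\<theta>. V n (a + cmul (cis \<theta>) b)) + e/2" using sub by simp
    also have "integral {0..2*pi} (\<lambda>\<theta>. V n (a + cmul (cis \<theta>) b)) \<le> integral {0..2*pi} (\<lambda>\<theta>. U (a + cmul (cis \<theta>) b) + e / (4*pi))"
    proof (rule integral_le)
      show "V n (a + cmul (cis x) b) \<le> U (a + cmul (cis x) b) + e / (4*pi)" for x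
        using n'[OF R(2)[of x]] by simp
      show "(\<lambda>\<theta>. V n (a + cmul (cis \<theta>) b)) integrable_on {0..2*pi}"
        by (intro integrable_continuous_interval continuous_on_subset[OF circ[OF cont]]) simp
      show "(\<lambda>\<theta>. U (a + cmul (cis \<theta>) b) + e / (4*pi)) integrable_on {0..2*pi}"
        by (intro integrable_continuous_interval continuous_on_add continuous_on_const continuous_on_subset[OF circ[OF U]]) simp
    qed
    also have "\<dots> = integral {0..2*pi} (\<lambda>\<theta>. U (a + cmul (cis \<theta>) b)) + e/2"
      by (subst integral_add) (auto intro!: integrable_continuous_interval continuous_on_subset[OF circ[OF U]])
    finally show "2*pi * U a \<le> integral {0..2*pi} (\<lambda>\<theta>. U (a + cmul (cis \<theta>) b)) + e" by simp
  qed
  then show ?thesis unfolding plurisubharmonic_def using usc_on_ereal[OF U] by simp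
qed

subsection \<open>Holomorphic functions of two variables\<close>


declare split_paired_All [simp del] split_paired_Ex [simp del] split_paired_all [simp del]

text \<open>Holomorphy in Osgood's sense: continuous, and holomorphic along every complex line. Unlike Frechet
  differentiability it passes trivially to uniform limits, and the two notions agree
  (\<open>sc_holomorphic_on_has_derivative\<close>).\<close>

definition sc_holomorphic_on :: "(C2 \<Rightarrow> complex) \<Rightarrow> C2 set \<Rightarrow> bool" where
  "sc_holomorphic_on f U \<longleftrightarrow> open U \<and> continuous_on U f \<and>
     (\<forall>q\<in>U. \<forall>e. (\<lambda>\<zeta>. f (q + cmul \<zeta> e)) field_differentiable at 0)"

definition dir_deriv :: "C2 \<Rightarrow> (C2 \<Rightarrow> complex) \<Rightarrow> C2 \<Rightarrow> complex" where
  "dir_deriv e f q = deriv (\<lambda>\<zeta>. f (q + cmul \<zeta> e)) 0"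

lemma cmul_0 [simp]: "cmul 0 e = 0"
  by (simp add: cmul_def zero_prod_def)

lemma cmul_add_left: "cmul (a + b) e = cmul a e + cmul b e"
  by (simp add: cmul_def algebra_simps)

text \<open>Differentiability is required only at parameter 0 but at every base point; moving the
  base point along the line reaches all other parameters.\<close>

lemma sc_holomorphic_on_slice:
  assumes f: "sc_holomorphic_on f U" and S: "\<And>\<zeta>. \<zeta> \<in> S \<Longrightarrow> q + cmul \<zeta> e \<in> U"
  shows "(\<lambda>\<zeta>. f (q + cmul \<zeta> e)) holomorphic_on S"
  unfolding holomorphic_on_def
proof
  fix \<zeta> assume \<zeta>: "\<zeta> \<in> S"
  have 1: "(\<lambda>x. f ((q + cmul \<zeta> e) + cmul x e)) field_differentiable at (\<zeta> - \<zeta>)"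
    using f S[OF \<zeta>] unfolding sc_holomorphic_on_def by simp
  have "((\<lambda>x. f ((q + cmul \<zeta> e) + cmul x e)) \<circ> (\<lambda>x. x - \<zeta>)) field_differentiable at \<zeta>"
    using 1 by (intro field_differentiable_compose) (auto intro!: derivative_intros field_differentiable_diff)
  moreover have "(\<lambda>x. f ((q + cmul \<zeta> e) + cmul x e)) \<circ> (\<lambda>x. x - \<zeta>) = (\<lambda>x. f (q + cmul x e))"
    by (auto simp: o_def add.assoc cmul_add_left[symmetric])
  ultimately show "(\<lambda>\<zeta>. f (q + cmul \<zeta> e)) field_differentiable at \<zeta> within S"
    by (simp add: field_differentiable_at_within)
qed

lemma sc_holomorphic_on_subset:
  "sc_holomorphic_on f U \<Longrightarrow> open V \<Longrightarrow> V \<subseteq> U \<Longrightarrow> sc_holomorphic_on f V"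
  unfolding sc_holomorphic_on_def by (blast intro: continuous_on_subset)

lemma sc_holomorphic_on_local:
  assumes "open U" "\<And>q. q \<in> U \<Longrightarrow> \<exists>V. q \<in> V \<and> sc_holomorphic_on f V"
  shows "sc_holomorphic_on f U"
  unfolding sc_holomorphic_on_def
proof (intro conjI ballI allI)
  show "continuous_on U f"
    using assms unfolding sc_holomorphic_on_def
    by (meson continuous_at_imp_continuous_on continuous_on_eq_continuous_at)
  show "(\<lambda>\<zeta>. f (q + cmul \<zeta> e)) field_differentiable at 0" if "q \<in> U" for q e
    using assms(2)[OF that] unfolding sc_holomorphic_on_def by blast
qed (rule assms(1))

lemma slice_in_open:
  assumes "open U" "q \<in> U"
  obtains r where "r > 0" "\<And>\<zeta>. \<zeta> \<in> cball 0 r \<Longrightarrow> q + cmul \<zeta> e \<in> U"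
proof -
  have "continuous_on UNIV (\<lambda>\<zeta>. q + cmul \<zeta> e)"
    unfolding cmul_def by (intro continuous_intros)
  then have "open ((\<lambda>\<zeta>. q + cmul \<zeta> e) -` U)" using assms(1) open_vimage by blast
  moreover have "0 \<in> (\<lambda>\<zeta>. q + cmul \<zeta> e) -` U" using assms(2) by simp
  ultimately obtain r where "r > 0" "cball 0 r \<subseteq> (\<lambda>\<zeta>. q + cmul \<zeta> e) -` U"
    using open_contains_cball by blast
  then show ?thesis using that by blast
qed

text \<open>The one-variable Weierstrass theorem is applied on a small disc in each slice. The
  convergence of derivatives later carries the gradient bound over to the limiting defining
  function.\<close>

lemma sc_holomorphic_on_uniform_limit:
  assumes f: "\<And>n. sc_holomorphic_on (f n) U" and lim: "uniform_limit U f g sequentially"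
  shows "sc_holomorphic_on g U"
    and "q \<in> U \<Longrightarrow> (\<lambda>n. dir_deriv e (f n) q) \<longlonglongrightarrow> dir_deriv e g q"
proof -
  have U: "open U" using f unfolding sc_holomorphic_on_def by blast
  have slice: "\<exists>g'. ((\<lambda>\<zeta>. g (q + cmul \<zeta> e)) has_field_derivative g') (at 0) \<and>
      (\<lambda>n. dir_deriv e (f n) q) \<longlonglongrightarrow> g'" if q: "q \<in> U" for q e
  proof -
    obtain r where r: "r > 0" "\<And>\<zeta>. \<zeta> \<in> cball 0 r \<Longrightarrow> q + cmul \<zeta> e \<in> U"
      using slice_in_open[OF U q] by metis
    have hol: "(\<lambda>\<zeta>. f n (q + cmul \<zeta> e)) holomorphic_on cball 0 r" for n
      using sc_holomorphic_on_slice[OF f] r(2) by blast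
    have dv: "((\<lambda>\<zeta>. f n (q + cmul \<zeta> e)) has_field_derivative deriv (\<lambda>\<zeta>. f n (q + cmul \<zeta> e)) x) (at x)"
      if "x \<in> ball 0 r" for n x
      by (rule holomorphic_derivI[OF holomorphic_on_subset[OF hol ball_subset_cball] open_ball that])
    obtain g' where g': "\<And>w. w \<in> ball 0 r \<Longrightarrow> ((\<lambda>\<zeta>. g (q + cmul \<zeta> e)) has_field_derivative g' w) (at w) \<and>
        (\<lambda>n. deriv (\<lambda>\<zeta>. f n (q + cmul \<zeta> e)) w) \<longlonglongrightarrow> g' w"
    proof (rule has_complex_derivative_uniform_limit[of 0 r "\<lambda>n \<zeta>. f n (q + cmul \<zeta> e)" "\<lambda>n. deriv (\<lambda>\<zeta>. f n (q + cmul \<zeta> e))" sequentially "\<lambda>\<zeta>. g (q + cmul \<zeta> e)"])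
      show "\<forall>\<^sub>F n in sequentially. continuous_on (cball 0 r) (\<lambda>\<zeta>. f n (q + cmul \<zeta> e)) \<and>
          (\<forall>w\<in>ball 0 r. ((\<lambda>\<zeta>. f n (q + cmul \<zeta> e)) has_field_derivative deriv (\<lambda>\<zeta>. f n (q + cmul \<zeta> e)) w) (at w))"
        using holomorphic_on_imp_continuous_on[OF hol] dv by (intro always_eventually) blast
      show "uniform_limit (cball 0 r) (\<lambda>n \<zeta>. f n (q + cmul \<zeta> e)) (\<lambda>\<zeta>. g (q + cmul \<zeta> e)) sequentially"
        by (rule uniform_limit_compose'[OF lim]) (use r(2) in blast)
    qed (use r in auto)
    show ?thesis using g'[of 0] r(1) by (auto simp: dir_deriv_def)
  qed
  show "sc_holomorphic_on g U"
    unfolding sc_holomorphic_on_def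
  proof (intro conjI ballI allI U)
    show "continuous_on U g"
      by (rule uniform_limit_theorem[OF _ lim])
        (use f in \<open>auto simp: sc_holomorphic_on_def\<close>)
    show "(\<lambda>\<zeta>. g (q + cmul \<zeta> e)) field_differentiable at 0" if "q \<in> U" for q e
      using slice[OF that, of e] by (auto simp: field_differentiable_def)
  qed
  show "(\<lambda>n. dir_deriv e (f n) q) \<longlonglongrightarrow> dir_deriv e g q" if "q \<in> U"
    using slice[OF that, of e] by (auto simp: dir_deriv_def dest!: DERIV_imp_deriv)
qed

text \<open>Cauchy's estimate on discs of radius \<open>d/4\<close> bounds the second derivative on
  \<open>ball 0 (d/2)\<close> by \<open>2 * M / (d/4)^2 = 32 * M / d^2\<close>, and Taylor's formula
  does the rest. The bound depends only on \<open>M\<close> and \<open>d\<close>, so it is uniform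
  in the base point of a slice.\<close>

lemma difference_quotient_bound:
  assumes g: "g holomorphic_on ball 0 d" and M: "\<And>x. x \<in> ball 0 d \<Longrightarrow> cmod (g x) \<le> M"
    and h: "h \<noteq> 0" "cmod h < d/2"
  shows "cmod ((g h - g 0) / h - deriv g 0) \<le> 32 * M / d\<^sup>2 * cmod h"
proof -
  have d: "d > 0" using h norm_ge_zero[of h] by linarith
  have dv: "((deriv ^^ i) g has_field_derivative (deriv ^^ Suc i) g x) (at x within ball 0 (d/2))"
    if "x \<in> ball 0 (d/2)" for i x
  proof -
    have "(deriv ^^ i) g holomorphic_on ball 0 d" by (intro holomorphic_higher_deriv g) auto
    moreover have "x \<in> ball 0 d" using that d by auto
    ultimately have "((deriv ^^ i) g has_field_derivative deriv ((deriv ^^ i) g) x) (at x)"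
      using holomorphic_derivI open_ball by blast
    then show ?thesis by (simp add: has_field_derivative_at_within)
  qed
  have bd: "cmod ((deriv ^^ Suc 1) g x) \<le> fact 2 * M / (d/4)^2" if x: "x \<in> ball 0 (d/2)" for x
  proof -
    have sub: "cball x (d/4) \<subseteq> ball 0 d"
    proof
      fix y assume "y \<in> cball x (d/4)"
      then show "y \<in> ball 0 d" using x d dist_triangle[of 0 y x] by auto
    qed
    have "cmod ((deriv ^^ 2) g x) \<le> fact 2 * M / (d/4)^2"
    proof (rule Cauchy_inequality)
      show "g holomorphic_on ball x (d/4)" using g sub by (meson ball_subset_cball holomorphic_on_subset)
      show "continuous_on (cball x (d/4)) g" using g sub holomorphic_on_imp_continuous_on holomorphic_on_subset by blast
      show "cmod (g y) \<le> M" if "cmod (x - y) = d/4" for y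
        using that sub by (intro M) (auto simp: dist_norm)
    qed (use d in auto)
    then show ?thesis by (simp add: numeral_2_eq_2)
  qed
  have "cmod ((deriv ^^ 0) g h - (\<Sum>i\<le>1. (deriv ^^ i) g 0 * (h - 0)^i / fact i)) \<le> (fact 2 * M / (d/4)^2) * cmod (h - 0)^Suc 1 / fact 1"
    by (rule complex_Taylor[of "ball 0 (d/2)" 1 "\<lambda>i. (deriv ^^ i) g"]) (use dv bd h d in auto)
  then have "cmod (g h - g 0 - deriv g 0 * h) \<le> 32 * M / d\<^sup>2 * (cmod h)\<^sup>2"
    by (simp add: power2_eq_square field_simps)
  moreover have "(g h - g 0) / h - deriv g 0 = (g h - g 0 - deriv g 0 * h) / h"
    using h by (simp add: field_simps)
  ultimately show ?thesis using h
    by (simp add: norm_divide divide_le_eq power2_eq_square mult.assoc)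
qed

lemma sc_holomorphic_on_const [simp]: "open U \<Longrightarrow> sc_holomorphic_on (\<lambda>_. c) U"
  by (simp add: sc_holomorphic_on_def)

lemma sc_holomorphic_on_add:
  "sc_holomorphic_on f U \<Longrightarrow> sc_holomorphic_on g U \<Longrightarrow> sc_holomorphic_on (\<lambda>q. f q + g q) U"
  by (auto simp: sc_holomorphic_on_def intro!: continuous_intros field_differentiable_add)

lemma sc_holomorphic_on_mult:
  "sc_holomorphic_on f U \<Longrightarrow> sc_holomorphic_on g U \<Longrightarrow> sc_holomorphic_on (\<lambda>q. f q * g q) U"
  by (auto simp: sc_holomorphic_on_def intro!: continuous_intros field_differentiable_mult)

lemma sc_holomorphic_on_compose:
  assumes f: "sc_holomorphic_on f U" and g: "g holomorphic_on S" "open S" "f ` U \<subseteq> S"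
  shows "sc_holomorphic_on (\<lambda>q. g (f q)) U"
  unfolding sc_holomorphic_on_def
proof (intro conjI ballI allI)
  show "continuous_on U (\<lambda>q. g (f q))"
    using f g by (intro continuous_on_compose2[OF holomorphic_on_imp_continuous_on[OF g(1)]])
      (auto simp: sc_holomorphic_on_def)
  fix q e assume q: "q \<in> U"
  have "g field_differentiable at (f (q + cmul 0 e))"
    using q g by (auto simp: holomorphic_on_imp_differentiable_at)
  then have "(g \<circ> (\<lambda>\<zeta>. f (q + cmul \<zeta> e))) field_differentiable at 0"
    using f q by (intro field_differentiable_compose) (auto simp: sc_holomorphic_on_def)
  then show "(\<lambda>\<zeta>. g (f (q + cmul \<zeta> e))) field_differentiable at 0" by (simp add: o_def)
qed (use f in \<open>simp add: sc_holomorphic_on_def\<close>)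

lemma sc_holomorphic_on_translate:
  assumes f: "sc_holomorphic_on f U" and V: "open V" "\<And>q. q \<in> V \<Longrightarrow> q + a \<in> U"
  shows "sc_holomorphic_on (\<lambda>q. f (q + a)) V"
  unfolding sc_holomorphic_on_def
proof (intro conjI ballI allI V(1))
  show "continuous_on V (\<lambda>q. f (q + a))"
  proof (rule continuous_on_compose2[of U f])
    show "continuous_on U f" using f by (simp add: sc_holomorphic_on_def)
    show "continuous_on V (\<lambda>q. q + a)" by (intro continuous_on_add continuous_on_id continuous_on_const)
  qed (use V(2) in blast)
  fix q e assume "q \<in> V"
  then have "(\<lambda>\<zeta>. f ((q + a) + cmul \<zeta> e)) field_differentiable at 0"
    using f V(2) unfolding sc_holomorphic_on_def by blast
  moreover have "q + a + cmul \<zeta> e = q + cmul \<zeta> e + a" for \<zeta> by (simp only: ac_simps)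
  ultimately show "(\<lambda>\<zeta>. f (q + cmul \<zeta> e + a)) field_differentiable at 0" by (simp only:)
qed

text \<open>Difference quotients with a fixed step are combinations of translates of
  \<open>f\<close>, hence holomorphic, and they converge locally uniformly to the directional
  derivative.\<close>

lemma sc_holomorphic_on_dir_deriv:
  assumes f: "sc_holomorphic_on f U"
  shows "sc_holomorphic_on (dir_deriv e f) U"
proof (rule sc_holomorphic_on_local)
  show U: "open U" using f by (simp add: sc_holomorphic_on_def)
  fix q0 assume q0: "q0 \<in> U"
  obtain R where R: "R > 0" "cball q0 R \<subseteq> U" using U q0 open_contains_cball by blast
  have fc: "continuous_on (cball q0 R) f" using f R(2) continuous_on_subset by (auto simp: sc_holomorphic_on_def)
  have "bounded (f ` cball q0 R)"
    by (intro compact_imp_bounded compact_continuous_image fc) simp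
  then obtain M where M: "\<And>q. q \<in> cball q0 R \<Longrightarrow> cmod (f q) \<le> M"
    unfolding bounded_iff by blast
  define V where "V = ball q0 (R/2)"
  \<comment> \<open>Moving a point of \<open>V\<close> by \<open>cmul \<zeta> e\<close> with
    \<open>cmod \<zeta> \<le> d\<close> displaces it by at most \<open>R/2\<close>, so it stays in
    the ball on which \<open>f\<close> is bounded by \<open>M\<close>.\<close>
  define d where "d = R / (2 * (norm e + 1))"
  have d: "d > 0" using R(1) by (simp add: d_def add_nonneg_pos)
  have in_R: "q + cmul \<zeta> e \<in> cball q0 R" if "q \<in> V" "cmod \<zeta> \<le> d" for q \<zeta>
  proof -
    have "cmod \<zeta> * norm e \<le> d * (norm e + 1)" using that(2) d by (intro mult_mono) auto
    also have "\<dots> = R/2" by (simp add: d_def field_simps add_nonneg_eq_0_iff)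
    finally have "norm (cmul \<zeta> e) \<le> R/2" by (simp add: norm_cmul)
    moreover have "dist q0 q < R/2" using that(1) by (simp add: V_def)
    ultimately show ?thesis using norm_triangle_ineq4[of "q0 - q" "cmul \<zeta> e"] by (simp add: dist_norm algebra_simps)
  qed
  \<comment> \<open>The offset 3 keeps all steps below \<open>d/2\<close>, as the quotient bound
    requires.\<close>
  define h where "h n = complex_of_real (d / (real n + 3))" for n
  have h: "h n \<noteq> 0" "cmod (h n) < d/2" "cmod (h n) = d / (real n + 3)" for n
    using d unfolding h_def norm_of_real
    by (auto simp: field_simps add_pos_nonneg simp del: of_real_divide of_real_add)
  define Q where "Q n q = (f (q + cmul (h n) e) + (- 1) * f q) * (1 / h n)" for n q
  have Q: "sc_holomorphic_on (Q n) V" for n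
    unfolding Q_def
  proof (intro sc_holomorphic_on_mult sc_holomorphic_on_add sc_holomorphic_on_const)
    show "sc_holomorphic_on (\<lambda>q. f (q + cmul (h n) e)) V"
    proof (rule sc_holomorphic_on_translate[OF f])
      show "q + cmul (h n) e \<in> U" if "q \<in> V" for q using in_R[OF that, of "h n"] h(2)[of n] d R(2) by auto
    qed (simp add: V_def)
    have "V \<subseteq> U" using R by (auto simp: V_def subset_iff)
    then show "sc_holomorphic_on f V" using sc_holomorphic_on_subset[OF f] by (simp add: V_def)
  qed (simp_all add: V_def)
  have est: "cmod (Q n q - dir_deriv e f q) \<le> 32 * M / d\<^sup>2 * (d / (real n + 3))" if q: "q \<in> V" for n q
  proof -
    have "cmod ((f (q + cmul (h n) e) - f (q + cmul 0 e)) / h n - deriv (\<lambda>\<zeta>. f (q + cmul \<zeta> e)) 0) \<le> 32 * M / d\<^sup>2 * cmod (h n)"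
    proof (rule difference_quotient_bound[OF _ _ h(1,2)])
      show "(\<lambda>\<zeta>. f (q + cmul \<zeta> e)) holomorphic_on ball 0 d"
        by (rule sc_holomorphic_on_slice[OF f]) (use in_R[OF q] R(2) in auto)
      show "cmod (f (q + cmul x e)) \<le> M" if "x \<in> ball 0 d" for x
        by (rule M[OF in_R[OF q]]) (use that in auto)
    qed
    then show ?thesis by (simp add: Q_def dir_deriv_def h(3))
  qed
  have "uniform_limit V Q (dir_deriv e f) sequentially"
    unfolding uniform_limit_iff
  proof (intro allI impI)
    fix \<epsilon> :: real assume \<epsilon>: "\<epsilon> > 0"
    have "(\<lambda>n. 32 * M / d\<^sup>2 * (d / (real n + 3))) \<longlonglongrightarrow> 0" by real_asymp
    then have "\<forall>\<^sub>F n in sequentially. 32 * M / d\<^sup>2 * (d / (real n + 3)) < \<epsilon>"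
      using \<epsilon> order_tendstoD(2) by blast
    then show "\<forall>\<^sub>F n in sequentially. \<forall>q\<in>V. dist (Q n q) (dir_deriv e f q) < \<epsilon>"
      by eventually_elim (use est in \<open>auto simp: dist_norm intro: le_less_trans\<close>)
  qed
  then have "sc_holomorphic_on (dir_deriv e f) V" by (rule sc_holomorphic_on_uniform_limit(1)[OF Q])
  then show "\<exists>V. q0 \<in> V \<and> sc_holomorphic_on (dir_deriv e f) V" 
    using R(1) by (intro exI[of _ V]) (simp add: V_def)
qed

text \<open>Both partial derivatives exist along the coordinate lines, and one of them is continuous
  by \<open>sc_holomorphic_on_dir_deriv\<close>; this suffices for total differentiability. The
  chain rule along lines then identifies the differential with the directional derivatives.\<close>

lemma sc_holomorphic_on_has_derivative:
  assumes f: "sc_holomorphic_on f U" and q: "q \<in> U"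
  shows "(f has_derivative (\<lambda>v. dir_deriv v f q)) (at q)"
proof -
  define f1 where "f1 = dir_deriv (1,0) f"
  define f2 where "f2 = dir_deriv (0,1) f"
  have U: "open U" using f by (simp add: sc_holomorphic_on_def)
  obtain A B where AB: "open A" "open B" "q \<in> A \<times> B" "A \<times> B \<subseteq> U"
    using open_prod_elim[OF U q] by metis
  obtain r where r: "r > 0" "ball (snd q) r \<subseteq> B" using AB by (metis mem_Times_iff open_contains_ball)
  define Y where "Y = ball (snd q) r"
  have Y: "open Y" "convex Y" "snd q \<in> Y" "Y \<subseteq> B" using r by (auto simp: Y_def)
  have d1: "((\<lambda>x. f (x, y)) has_field_derivative f1 (x, y)) (at x)" if "(x, y) \<in> U" for x y
  proof -
    have "((\<lambda>\<zeta>. f ((x, y) + cmul \<zeta> (1,0))) has_field_derivative f1 (x, y)) (at 0)"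
      using f that field_differentiable_derivI by (auto simp: f1_def dir_deriv_def sc_holomorphic_on_def)
    then have "((\<lambda>\<zeta>. f (\<zeta> + x, y)) has_field_derivative f1 (x, y)) (at 0)"
      by (simp add: cmul_def add.commute)
    then show ?thesis using DERIV_shift[of "\<lambda>x. f (x, y)" "f1 (x, y)" 0 x] by simp
  qed
  have d2: "((\<lambda>y. f (x, y)) has_field_derivative f2 (x, y)) (at y)" if "(x, y) \<in> U" for x y
  proof -
    have "((\<lambda>\<zeta>. f ((x, y) + cmul \<zeta> (0,1))) has_field_derivative f2 (x, y)) (at 0)"
      using f that field_differentiable_derivI by (auto simp: f2_def dir_deriv_def sc_holomorphic_on_def)
    then have "((\<lambda>\<zeta>. f (x, \<zeta> + y)) has_field_derivative f2 (x, y)) (at 0)"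
      by (simp add: cmul_def add.commute)
    then show ?thesis using DERIV_shift[of "\<lambda>y. f (x, y)" "f2 (x, y)" 0 y] by simp
  qed
  have "((\<lambda>(x, y). f (x, y)) has_derivative (\<lambda>(tx, ty). f1 q * tx + blinfun_apply (blinfun_mult_right (f2 (fst q, snd q))) ty)) (at (fst q, snd q) within A \<times> Y)"
  proof (rule has_derivative_partialsI)
    show "((\<lambda>x. f (x, snd q)) has_derivative (*) (f1 q)) (at (fst q) within A)"
      using d1[of "fst q" "snd q"] q by (auto simp: has_field_derivative_def intro: has_derivative_at_withinI)
    show "((\<lambda>y. f (x, y)) has_derivative blinfun_apply (blinfun_mult_right (f2 (x, y)))) (at y within Y)"
      if "x \<in> A" "y \<in> Y" for x y
    proof -
      have "(x, y) \<in> U" using that AB(4) Y(4) by auto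
      from d2[OF this] show ?thesis
        by (auto simp: has_field_derivative_def blinfun_mult_right.rep_eq intro: has_derivative_at_withinI)
    qed
    have "continuous_on U f2" using sc_holomorphic_on_dir_deriv[OF f] by (simp add: f2_def sc_holomorphic_on_def)
    then have "continuous (at q within A \<times> Y) f2"
      using q U continuous_on_eq_continuous_at continuous_at_imp_continuous_at_within by blast
    then have "continuous (at q within A \<times> Y) (\<lambda>q. blinfun_mult_right (f2 q))"
      by (rule bounded_linear.continuous[OF bounded_linear_blinfun_mult_right])
    then show "continuous (at (fst q, snd q) within A \<times> Y) (\<lambda>(x, y). blinfun_mult_right (f2 (x, y)))"
      by (simp add: case_prod_unfold)
  qed (use Y in auto)
  moreover have "at (fst q, snd q) within A \<times> Y = at q"
    using AB Y by (subst at_within_open) (auto simp: open_Times mem_Times_iff)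
  ultimately have D: "(f has_derivative (\<lambda>v. f1 q * fst v + f2 q * snd v)) (at q)"
    by (simp add: case_prod_unfold blinfun_mult_right.rep_eq)
  have "dir_deriv v f q = f1 q * fst v + f2 q * snd v" for v
  proof -
    have "((\<lambda>\<zeta>. q + cmul \<zeta> v) has_derivative (\<lambda>h. cmul h v)) (at 0)"
      unfolding cmul_def by (auto intro!: derivative_eq_intros simp: zero_prod_def)
    moreover have "(f has_derivative (\<lambda>v. f1 q * fst v + f2 q * snd v)) (at (q + cmul 0 v))" using D by simp
    ultimately have "(f \<circ> (\<lambda>\<zeta>. q + cmul \<zeta> v) has_derivative (\<lambda>v. f1 q * fst v + f2 q * snd v) \<circ> (\<lambda>h. cmul h v)) (at 0)"
      by (rule diff_chain_at)
    moreover have "(\<lambda>v. f1 q * fst v + f2 q * snd v) \<circ> (\<lambda>h. cmul h v) = (\<lambda>h. (f1 q * fst v + f2 q * snd v) * h)"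
      by (auto simp: cmul_def algebra_simps)
    ultimately have "((\<lambda>\<zeta>. f (q + cmul \<zeta> v)) has_derivative (\<lambda>h. (f1 q * fst v + f2 q * snd v) * h)) (at 0)"
      by (simp add: o_def)
    then show ?thesis unfolding dir_deriv_def by (intro DERIV_imp_deriv) (simp add: has_field_derivative_def)
  qed
  then show ?thesis using D by simp
qed

lemma dir_deriv_cmul:
  assumes f: "sc_holomorphic_on f U" and q: "q \<in> U"
  shows "dir_deriv (cmul c e) f q = c * dir_deriv e f q"
proof -
  have 1: "((\<lambda>\<zeta>. f (q + cmul \<zeta> e)) has_field_derivative dir_deriv e f q) (at (0 * c))"
    using f q unfolding dir_deriv_def sc_holomorphic_on_def by (simp add: field_differentiable_derivI)
  have 2: "((\<lambda>\<zeta>. \<zeta> * c) has_field_derivative c) (at 0)" by (auto intro!: derivative_eq_intros)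
  have "((\<lambda>\<zeta>. f (q + cmul \<zeta> (cmul c e))) has_field_derivative c * dir_deriv e f q) (at 0)"
    using DERIV_chain2[OF 1 2] by (simp add: cmul_cmul mult.commute)
  then show ?thesis by (simp add: dir_deriv_def DERIV_imp_deriv)
qed

section \<open>Smoothness of real parts of holomorphic functions\<close>

lemma frechet_derivative_Re_sc_holomorphic:
  assumes "sc_holomorphic_on f U" "q \<in> U"
  shows "((\<lambda>q. Re (f q)) has_derivative (\<lambda>v. Re (dir_deriv v f q))) (at q)"
    and "frechet_derivative (\<lambda>q. Re (f q)) (at q) = (\<lambda>v. Re (dir_deriv v f q))"
proof -
  show 1: "((\<lambda>q. Re (f q)) has_derivative (\<lambda>v. Re (dir_deriv v f q))) (at q)"
    using bounded_linear.has_derivative[OF bounded_linear_Re sc_holomorphic_on_has_derivative[OF assms]] .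
  show "frechet_derivative (\<lambda>q. Re (f q)) (at q) = (\<lambda>v. Re (dir_deriv v f q))"
    using frechet_derivative_at[OF 1] by simp
qed

text \<open>The derivative of a real part is known in closed form only on \<open>U\<close>, so the
  induction on the order of smoothness must allow replacing a function by one that agrees with it
  there.\<close>

lemma Ck_on_cong:
  assumes "open U" "\<And>q. q \<in> U \<Longrightarrow> f q = g q" "Ck_on k f U"
  shows "Ck_on k g U"
  using assms(2,3)
proof (induction k arbitrary: f g)
  case 0
  then show ?case by (auto intro: continuous_on_eq)
next
  case (Suc k)
  have D: "(g has_derivative frechet_derivative f (at q)) (at q)" if "q \<in> U" for q
  proof -
    have "(f has_derivative frechet_derivative f (at q)) (at q)"
      using Suc.prems(2) that frechet_derivative_works by auto
    then show ?thesis
      by (rule has_derivative_transform_within_open[OF _ assms(1) that]) (simp add: Suc.prems(1))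
  qed
  have "Ck_on k (\<lambda>z. frechet_derivative g (at z) v) U" for v
  proof (rule Suc.IH)
    show "Ck_on k (\<lambda>z. frechet_derivative f (at z) v) U" using Suc.prems(2) by simp
    show "frechet_derivative f (at q) v = frechet_derivative g (at q) v" if "q \<in> U" for q
      using frechet_derivative_at[OF D[OF that]] by simp
  qed
  then show ?case using D unfolding Ck_on.simps differentiable_def by blast
qed

text \<open>Real parts of holomorphic functions are closed under directional derivatives, so one
  induction covers all orders.\<close>

lemma Ck_on_Re_sc_holomorphic:
  assumes "sc_holomorphic_on f U"
  shows "Ck_on k (\<lambda>q. Re (f q)) U"
  using assms
proof (induction k arbitrary: f)
  case 0
  then show ?case by (auto simp: sc_holomorphic_on_def intro!: continuous_intros)
next
  case (Suc k)
  have "Ck_on k (\<lambda>z. frechet_derivative (\<lambda>q. Re (f q)) (at z) v) U" for v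
  proof (rule Ck_on_cong)
    show "open U" using Suc.prems by (simp add: sc_holomorphic_on_def)
    show "Ck_on k (\<lambda>q. Re (dir_deriv v f q)) U"
      by (rule Suc.IH[OF sc_holomorphic_on_dir_deriv[OF Suc.prems]])
    show "Re (dir_deriv v f q) = frechet_derivative (\<lambda>q. Re (f q)) (at q) v" if "q \<in> U" for q
      by (simp add: frechet_derivative_Re_sc_holomorphic(2)[OF Suc.prems that])
  qed
  moreover have "\<forall>z\<in>U. (\<lambda>q. Re (f q)) differentiable (at z)"
    using frechet_derivative_Re_sc_holomorphic(1)[OF Suc.prems] unfolding differentiable_def by blast
  ultimately show ?case by simp
qed

subsection \<open>Compositions of Henon maps\<close>


text \<open>The \<open>n\<close>-th composition is \<open>(P (n + 2), P (n + 1))\<close>, and \<open>G n\<close> is the complex gradient of \<open>P n\<close>.\<close>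

locale henon_sequence =
  fixes a :: "nat \<Rightarrow> real" and P :: "nat \<Rightarrow> C2 \<Rightarrow> complex" and G :: "nat \<Rightarrow> C2 \<Rightarrow> C2"
  assumes a_pos: "0 < a n" and a_le: "a n \<le> 1/16"
    and P_0: "P 0 q = snd q" and P_1: "P (Suc 0) q = fst q"
    and P_SS: "P (Suc (Suc n)) q = (P (Suc n) q)\<^sup>2 + of_real (a n) * P n q"
    and G_0: "G 0 q = (0, 1)" and G_1: "G (Suc 0) q = (1, 0)"
    and G_SS: "G (Suc (Suc n)) q = cmul (2 * P (Suc n) q) (G (Suc n) q) + cmul (of_real (a n)) (G n q)"
begin

definition F :: "nat \<Rightarrow> C2 \<Rightarrow> C2" where
  "F n = henon (of_real (a n))"

text \<open>With these weights the unit ball is mapped into itself from one step to the next.\<close>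

definition H :: "nat \<Rightarrow> C2 \<Rightarrow> C2" where
  "H n q = (4 * P (Suc (Suc n)) q, 2 * P (Suc n) q)"

lemma comp_seq_F: "comp_seq F n q = (P (Suc (Suc n)) q, P (Suc n) q)"
  by (induction n) (simp_all add: F_def henon_def P_SS P_1 P_0)

lemma F_automorphism: "holomorphic_automorphism (F n)"
  using a_pos[of n] unfolding F_def by (intro henon_automorphism) simp

lemma F_attracting: "attracting_fixed_point_at_0 (F n)"
  using a_pos[of n] a_le[of n] unfolding F_def by (intro henon_attracting) simp

lemma comp_seq_automorphism: "holomorphic_automorphism (comp_seq F n)"
proof (induction n)
  case (Suc n)
  then show ?case
    unfolding comp_seq.simps by (rule holomorphic_automorphism_compose[OF F_automorphism])
qed (simp add: F_automorphism)

lemma H_automorphism: "holomorphic_automorphism (H n)"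
proof -
  define T :: "C2 \<Rightarrow> C2" where "T = (\<lambda>q. (4 * fst q, 2 * snd q))"
  define S :: "C2 \<Rightarrow> C2" where "S = (\<lambda>q. (fst q / 4, snd q / 2))"
  have TS: "T (S q) = q" "S (T q) = q" for q by (auto simp: T_def S_def)
  have inv: "inv T = S" using TS by (intro inv_equality) auto
  have "bij T" using TS by (metis bijI')
  moreover have "hol2 T UNIV"
    unfolding hol2_def
  proof
    fix z
    have "(T has_derivative T) (at z)"
      unfolding T_def by (auto intro!: derivative_eq_intros)
    moreover have "\<forall>c v. T (cmul c v) = cmul c (T v)" by (simp add: T_def cmul_def)
    ultimately show "\<exists>L. (T has_derivative L) (at z) \<and> (\<forall>c v. L (cmul c v) = cmul c (L v))" by blast
  qed
  moreover have "hol2 S UNIV"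
    unfolding hol2_def
  proof
    fix z
    have "(S has_derivative S) (at z)"
      unfolding S_def by (auto intro!: derivative_eq_intros)
    moreover have "\<forall>c v. S (cmul c v) = cmul c (S v)" by (simp add: S_def cmul_def)
    ultimately show "\<exists>L. (S has_derivative L) (at z) \<and> (\<forall>c v. L (cmul c v) = cmul c (L v))" by blast
  qed
  ultimately have "holomorphic_automorphism T" using inv by (simp add: holomorphic_automorphism_def)
  moreover have "H n = T \<circ> comp_seq F n" by (auto simp: H_def T_def comp_seq_F)
  ultimately show ?thesis using comp_seq_automorphism holomorphic_automorphism_compose by simp
qed

lemma P_has_derivative:
  "(P n has_derivative (\<lambda>v. fst (G n q) * fst v + snd (G n q) * snd v)) (at q)"
proof (induction n rule: induct_nat_012)
  case 0
  have "P 0 = snd" using P_0 by auto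
  then show ?case by (simp add: G_0 bounded_linear_imp_has_derivative bounded_linear_snd)
next
  case 1
  have "P (Suc 0) = fst" using P_1 by auto
  then show ?case by (simp add: G_1 bounded_linear_imp_has_derivative bounded_linear_fst)
next
  case (ge2 n)
  have "P (Suc (Suc n)) = (\<lambda>q. (P (Suc n) q)\<^sup>2 + of_real (a n) * P n q)" using P_SS by auto
  then show ?case
    using ge2 by (auto intro!: derivative_eq_intros simp: G_SS cmul_def algebra_simps)
qed

lemma P_continuous: "continuous_on S (P n)"
  using P_has_derivative by (meson continuous_at_imp_continuous_on has_derivative_continuous)

lemma P_line_derivative:
  "((\<lambda>\<zeta>. P n (q + cmul \<zeta> v)) has_field_derivative
      fst (G n (q + cmul \<zeta> v)) * fst v + snd (G n (q + cmul \<zeta> v)) * snd v) (at \<zeta>)"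
proof -
  have "((\<lambda>\<zeta>. q + cmul \<zeta> v) has_derivative (\<lambda>h. cmul h v)) (at \<zeta>)"
    unfolding cmul_def by (auto intro!: derivative_eq_intros simp: zero_prod_def)
  from diff_chain_at[OF this P_has_derivative[of n]]
  have "(P n \<circ> (\<lambda>\<zeta>. q + cmul \<zeta> v) has_derivative (\<lambda>w. fst (G n (q + cmul \<zeta> v)) * fst w + snd (G n (q + cmul \<zeta> v)) * snd w) \<circ> (\<lambda>h. cmul h v)) (at \<zeta>)" .
  moreover have "(\<lambda>w. fst (G n (q + cmul \<zeta> v)) * fst w + snd (G n (q + cmul \<zeta> v)) * snd w) \<circ> (\<lambda>h. cmul h v) =
      (*) (fst (G n (q + cmul \<zeta> v)) * fst v + snd (G n (q + cmul \<zeta> v)) * snd v)"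
    by (auto simp: cmul_def algebra_simps)
  ultimately show ?thesis by (simp add: has_field_derivative_def o_def)
qed

lemma P_sc_holomorphic: "open U \<Longrightarrow> sc_holomorphic_on (P n) U"
  unfolding sc_holomorphic_on_def field_differentiable_def
  using P_continuous P_line_derivative by blast

text \<open>In the coordinates \<open>(X, Y)\<close> of \<open>H n q\<close> the next pair is
  \<open>(X^2/4 + 2*b*Y, X/2)\<close>. As \<open>cmod X \<le> 1\<close> and
  \<open>b \<le> 1/16\<close>, the first entry is at most \<open>cmod X / 4 + cmod Y / 8\<close>; a
  sum of squares then shows that the squared norm is at least halved.\<close>

lemma H_contracts:
  assumes "norm (H n q) < 1"
  shows "(norm (H (Suc n) q))\<^sup>2 \<le> (norm (H n q))\<^sup>2 / 2"
proof -
  define X where "X = 4 * P (Suc (Suc n)) q"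
  define Y where "Y = 2 * P (Suc n) q"
  define b where "b = a (Suc n)"
  have H1: "H n q = (X, Y)" by (simp add: H_def X_def Y_def)
  have H2: "H (Suc n) q = (X\<^sup>2 / 4 + of_real (2 * b) * Y, X / 2)"
    unfolding H_def P_SS[of "Suc n"] by (simp add: X_def Y_def b_def power2_eq_square)
  have nH: "(norm (H n q))\<^sup>2 = (cmod X)\<^sup>2 + (cmod Y)\<^sup>2" by (simp add: H1 norm_prod_def)
  have b: "0 < b" "b \<le> 1/16" using a_pos a_le by (simp_all add: b_def)
  have "cmod X \<le> norm (H n q)" using H1 norm_fst_le[of X Y] by simp
  then have X1: "cmod X \<le> 1" using assms by simp
  have "cmod (X\<^sup>2 / 4 + of_real (2 * b) * Y) \<le> cmod (X\<^sup>2 / 4) + cmod (of_real (2 * b) * Y)"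
    by (rule norm_triangle_ineq)
  also have "\<dots> = cmod X * cmod X / 4 + 2 * b * cmod Y"
    using b by (simp add: norm_divide norm_power norm_mult power2_eq_square)
  also have "\<dots> \<le> cmod X / 4 + cmod Y / 8"
    using mult_left_le[OF X1 norm_ge_zero[of X]] mult_right_mono[OF b(2) norm_ge_zero[of Y]] by simp
  finally have "(cmod (X\<^sup>2 / 4 + of_real (2 * b) * Y))\<^sup>2 \<le> (cmod X / 4 + cmod Y / 8)\<^sup>2"
    by (rule power_mono) simp
  moreover have "(cmod X / 4 + cmod Y / 8)\<^sup>2 \<le> (cmod X)\<^sup>2 / 4 + (cmod Y)\<^sup>2 / 2"
  proof -
    have "(cmod X)\<^sup>2 / 4 + (cmod Y)\<^sup>2 / 2 - (cmod X / 4 + cmod Y / 8)\<^sup>2 =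
        (cmod X - cmod Y)\<^sup>2 / 32 + 5 / 32 * (cmod X)\<^sup>2 + 29 / 64 * (cmod Y)\<^sup>2"
      by (simp add: power2_eq_square field_simps)
    also have "\<dots> \<ge> 0" by simp
    finally show ?thesis by simp
  qed
  moreover have "(norm (H (Suc n) q))\<^sup>2 = (cmod (X\<^sup>2 / 4 + of_real (2 * b) * Y))\<^sup>2 + (cmod X)\<^sup>2 / 4"
    unfolding H2 by (simp add: norm_prod_def norm_divide power_divide)
  ultimately show ?thesis unfolding nH by argo
qed

section \<open>The basin as an increasing union of preimages of the ball\<close>

lemma H_vimage_mono: "H n -` ball 0 1 \<subseteq> H (Suc n) -` ball 0 1"
proof
  fix q assume "q \<in> H n -` ball 0 1"
  then have n: "norm (H n q) < 1" by simp
  have "(norm (H n q))\<^sup>2 < 1" using n by (simp add: power_less_one_iff)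
  then have "(norm (H (Suc n) q))\<^sup>2 < 1" using H_contracts[OF n] zero_le_power2[of "norm (H n q)"] by linarith
  then show "q \<in> H (Suc n) -` ball 0 1" by (simp add: power_less_one_iff)
qed

lemma basin_iff_P: "q \<in> nonautonomous_basin F \<longleftrightarrow> (\<lambda>n. P n q) \<longlonglongrightarrow> 0"
proof
  assume "q \<in> nonautonomous_basin F"
  then have "(\<lambda>n. (P (Suc (Suc n)) q, P (Suc n) q)) \<longlonglongrightarrow> (0, 0)"
    by (simp add: nonautonomous_basin_def comp_seq_F zero_prod_def)
  from tendsto_snd[OF this] have "(\<lambda>n. P (Suc n) q) \<longlonglongrightarrow> 0" by simp
  then show "(\<lambda>n. P n q) \<longlonglongrightarrow> 0" by (rule LIMSEQ_imp_Suc)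
next
  assume L: "(\<lambda>n. P n q) \<longlonglongrightarrow> 0"
  show "q \<in> nonautonomous_basin F"
    unfolding nonautonomous_basin_def comp_seq_F zero_prod_def mem_Collect_eq
    by (intro tendsto_Pair LIMSEQ_Suc L)
qed

lemma H_tendsto_0: "(\<lambda>n. P n q) \<longlonglongrightarrow> 0 \<Longrightarrow> (\<lambda>n. H n q) \<longlonglongrightarrow> 0"
  unfolding H_def zero_prod_def
  by (intro tendsto_Pair tendsto_mult_right_zero LIMSEQ_Suc)

text \<open>An orbit tending to 0 eventually enters the weighted ball; once inside, its squared norm
  is halved at each step, so it tends to 0.\<close>

lemma basin_eq: "nonautonomous_basin F = (\<Union>n. H n -` ball 0 1)"
proof (intro equalityI subsetI)
  fix q assume "q \<in> nonautonomous_basin F"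
  then have "(\<lambda>n. norm (H n q)) \<longlonglongrightarrow> 0" using H_tendsto_0 basin_iff_P tendsto_norm_zero by blast
  then have "\<forall>\<^sub>F n in sequentially. norm (H n q) < 1" by (rule order_tendstoD) simp
  then obtain n where "norm (H n q) < 1" using eventually_happens'[OF sequentially_bot] by blast
  then show "q \<in> (\<Union>n. H n -` ball 0 1)" by auto
next
  fix q assume "q \<in> (\<Union>n. H n -` ball 0 1)"
  then obtain n where n: "q \<in> H n -` ball 0 1" by blast
  have b: "q \<in> H (n + m) -` ball 0 1" for m
  proof (induction m)
    case (Suc m)
    then show ?case using H_vimage_mono[of "n + m"] unfolding add_Suc_right by blast
  qed (use n in simp)
  have le: "(norm (H (n + m) q))\<^sup>2 \<le> (1/2) ^ m" for m
  proof (induction m)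
    case 0
    then show ?case using n by (simp add: power_le_one_iff)
  next
    case (Suc m)
    then show ?case using H_contracts[of "n + m" q] b[of m] by simp
  qed
  have "(\<lambda>m. (norm (H (n + m) q))\<^sup>2) \<longlonglongrightarrow> 0"
  proof (rule Lim_null_comparison[where g = "\<lambda>m. (1/2) ^ m"])
    show "\<forall>\<^sub>F m in sequentially. norm ((norm (H (n + m) q))\<^sup>2) \<le> (1/2) ^ m" using le by simp
  qed (intro LIMSEQ_power_zero, simp)
  from tendsto_real_sqrt[OF this] have "(\<lambda>m. norm (H (n + m) q)) \<longlonglongrightarrow> 0" by simp
  then have "(\<lambda>m. H (n + m) q) \<longlonglongrightarrow> 0" by (rule tendsto_norm_zero_cancel)
  from tendsto_divide[OF tendsto_snd[OF this] tendsto_const[of 2]]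
  have "(\<lambda>m. P (m + Suc n) q) \<longlonglongrightarrow> 0" by (simp add: H_def add.commute)
  then show "q \<in> nonautonomous_basin F" unfolding basin_iff_P by (rule LIMSEQ_offset)
qed

lemma basin_open: "open (nonautonomous_basin F)"
  unfolding basin_eq using biholomorphic_to_ball_vimage[OF H_automorphism]
  by (auto simp: biholomorphic_to_ball_def)

lemma P_at_0: "P n 0 = 0"
  by (induction n rule: induct_nat_012) (simp_all add: P_0 P_1 P_SS)

lemma H_0: "H n 0 = 0"
  by (simp add: H_def P_at_0 zero_prod_def[symmetric])

lemma basin_connected: "connected (nonautonomous_basin F)"
  unfolding basin_eq
proof (rule connected_Union)
  have "0 \<in> \<Inter> (range (\<lambda>n. H n -` ball 0 1))" by (simp add: H_0)
  then show "\<Inter> (range (\<lambda>n. H n -` ball 0 1)) \<noteq> {}" by blast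
qed (use connected_vimage_ball_automorphism[OF H_automorphism] in auto)

lemma line_derivative_tendsto_0:
  assumes q: "(\<lambda>n. P n q) \<longlonglongrightarrow> 0"
  shows "(\<lambda>n. fst (G n q) * fst v + snd (G n q) * snd v) \<longlonglongrightarrow> 0"
proof -
  define d where "d n = fst (G n q) * fst v + snd (G n q) * snd v" for n
  have dSS: "d (Suc (Suc n)) = 2 * P (Suc n) q * d (Suc n) + of_real (a n) * d n" for n
    by (simp add: d_def G_SS cmul_def algebra_simps)
  \<comment> \<open>Once \<open>cmod (P n q) < 1/8\<close>, the linear recursion for
    \<open>d\<close> has coefficients of size at most 1/4 and 1/16. With weight 1/2 on the older
    term, this sum shrinks by the factor 3/4 per step.\<close>
  define e where "e n = cmod (d (Suc n)) + cmod (d n) / 2" for n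
  have "(\<lambda>n. cmod (P n q)) \<longlonglongrightarrow> 0" using q by (rule tendsto_norm_zero)
  then have "\<forall>\<^sub>F n in sequentially. cmod (P n q) < 1/8" by (rule order_tendstoD) simp
  then obtain N where N: "\<And>n. n \<ge> N \<Longrightarrow> cmod (P n q) < 1/8" unfolding eventually_sequentially by blast
  have step: "e (Suc n) \<le> 3/4 * e n" if "n \<ge> N" for n
  proof -
    have "cmod (d (Suc (Suc n))) \<le> 2 * cmod (P (Suc n) q) * cmod (d (Suc n)) + a n * cmod (d n)"
      unfolding dSS using norm_triangle_ineq[of "2 * P (Suc n) q * d (Suc n)" "of_real (a n) * d n"] a_pos[of n]
      by (simp add: norm_mult)
    moreover have "2 * cmod (P (Suc n) q) * cmod (d (Suc n)) \<le> 1/4 * cmod (d (Suc n))"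
      using N[of "Suc n"] that by (intro mult_right_mono) auto
    moreover have "a n * cmod (d n) \<le> 1/16 * cmod (d n)" using a_le by (intro mult_right_mono) auto
    ultimately have "cmod (d (Suc (Suc n))) \<le> 1/4 * cmod (d (Suc n)) + 1/16 * cmod (d n)"
      by (meson add_mono order_trans)
    then show ?thesis using norm_ge_zero[of "d n"] unfolding e_def by argo
  qed
  have "e (N + m) \<le> e N * (3/4) ^ m" for m
  proof (induction m)
    case (Suc m)
    then show ?case using step[of "N + m"] by simp
  qed simp
  then have b: "cmod (d (m + Suc N)) \<le> e N * (3/4) ^ m" for m
  proof -
    have "cmod (d (m + Suc N)) \<le> e (N + m)" by (simp add: e_def add.commute)
    then show ?thesis using \<open>e (N + m) \<le> e N * (3/4) ^ m\<close> by simp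
  qed
  have "(\<lambda>m. e N * (3/4) ^ m) \<longlonglongrightarrow> 0"
    by (intro tendsto_mult_right_zero LIMSEQ_power_zero) simp
  then have "(\<lambda>m. d (m + Suc N)) \<longlonglongrightarrow> 0"
    by (rule Lim_null_comparison[rotated]) (use b in \<open>auto intro!: always_eventually\<close>)
  then have "d \<longlonglongrightarrow> 0" by (rule LIMSEQ_offset)
  then show ?thesis unfolding d_def .
qed

lemma basin_kobayashi:
  assumes "z \<in> nonautonomous_basin F"
  shows "kobayashi (nonautonomous_basin F) z v = 0"
proof (rule kobayashi_eq_0I)
  fix r :: real assume r: "r > 0"
  have Pz: "(\<lambda>n. P n z) \<longlonglongrightarrow> 0" using assms basin_iff_P by blast
  define d where "d n w = fst (G n z) * fst w + snd (G n z) * snd w" for n w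
  have d: "(\<lambda>n. d n v) \<longlonglongrightarrow> 0" unfolding d_def by (rule line_derivative_tendsto_0[OF Pz])
  define L where "L n w = (4 * d (Suc (Suc n)) w, 2 * d (Suc n) w)" for n w
  have "(\<lambda>n. L n v) \<longlonglongrightarrow> 0"
    unfolding L_def zero_prod_def by (intro tendsto_Pair tendsto_mult_right_zero LIMSEQ_Suc d)
  then have "(\<lambda>n. norm (L n v)) \<longlonglongrightarrow> 0" by (rule tendsto_norm_zero)
  then have "\<forall>\<^sub>F n in sequentially. norm (L n v) < r" using r order_tendstoD(2) by blast
  moreover have "(\<lambda>n. norm (H n z)) \<longlonglongrightarrow> 0" by (intro tendsto_norm_zero H_tendsto_0 Pz)
  then have "\<forall>\<^sub>F n in sequentially. norm (H n z) < 1/2" by (rule order_tendstoD) simp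
  ultimately have "\<forall>\<^sub>F n in sequentially. norm (L n v) < r \<and> norm (H n z) < 1/2" by (rule eventually_conj)
  then obtain n where n: "norm (L n v) < r" "norm (H n z) < 1/2"
    using eventually_happens'[OF sequentially_bot] by blast
  have "(H n has_derivative L n) (at z)"
  proof -
    have "((\<lambda>q. (4 * P (Suc (Suc n)) q, 2 * P (Suc n) q)) has_derivative (\<lambda>w. (4 * d (Suc (Suc n)) w, 2 * d (Suc n) w))) (at z)"
      unfolding d_def by (intro has_derivative_Pair has_derivative_mult_right P_has_derivative)
    then show ?thesis unfolding H_def[abs_def] L_def[abs_def] .
  qed
  moreover have "H n -` ball 0 1 \<subseteq> nonautonomous_basin F" unfolding basin_eq by blast
  ultimately show "\<exists>K M. holomorphic_automorphism K \<and> K -` ball 0 1 \<subseteq> nonautonomous_basin F \<and>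
      (K has_derivative M) (at z) \<and> norm (K z) < 1/2 \<and> norm (M v) < r"
    using n H_automorphism by blast
qed

end

subsection \<open>The bounded plurisubharmonic function\<close>


lemma uniform_limit_geometric:
  fixes f :: "nat \<Rightarrow> 'a \<Rightarrow> 'b::banach"
  assumes step: "\<And>n x. n \<ge> N \<Longrightarrow> x \<in> S \<Longrightarrow> norm (f (Suc n) x - f n x) \<le> C * (1/2) ^ n"
  shows "uniform_limit S f (\<lambda>x. lim (\<lambda>n. f n x)) sequentially"
    and "n \<ge> N \<Longrightarrow> x \<in> S \<Longrightarrow> norm (lim (\<lambda>n. f n x) - f n x) \<le> 2 * C * (1/2) ^ n"
proof -
  have C: "C \<ge> 0" if "x \<in> S" for x
  proof -
    have "0 \<le> C * (1/2) ^ N" using step[OF order_refl that] norm_ge_zero order_trans by blast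
    moreover have "(0::real) < (1/2) ^ N" by simp
    ultimately show ?thesis by (metis mult.commute zero_le_mult_iff not_le)
  qed
  \<comment> \<open>Subtracting the remaining tail \<open>2 * C * (1/2) ^ m\<close> makes the
    induction on \<open>m\<close> close exactly.\<close>
  have tel: "norm (f m x - f n x) \<le> 2 * C * (1/2) ^ n - 2 * C * (1/2) ^ m"
    if x: "x \<in> S" and n: "N \<le> n" "n \<le> m" for x n m
    using n(2)
  proof (induction m rule: dec_induct)
    case (step m)
    have "norm (f (Suc m) x - f n x) \<le> norm (f (Suc m) x - f m x) + norm (f m x - f n x)"
      using norm_triangle_ineq[of "f (Suc m) x - f m x" "f m x - f n x"] by simp
    also have "\<dots> \<le> C * (1/2) ^ m + (2 * C * (1/2) ^ n - 2 * C * (1/2) ^ m)"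
      using assms[of m x] x n(1) step by (intro add_mono) auto
    finally show ?case by simp
  qed simp
  have b: "norm (f m x - f n x) \<le> 2 * C * (1/2) ^ n" if "x \<in> S" "N \<le> n" "n \<le> m" for x n m
  proof -
    have "0 \<le> 2 * C * (1/2) ^ m" using C[OF that(1)] by simp
    then show ?thesis using tel[OF that] by linarith
  qed
  have small: "(\<lambda>n. 2 * C * (1/2) ^ n) \<longlonglongrightarrow> 0"
    by (intro tendsto_mult_right_zero LIMSEQ_power_zero) simp
  have conv: "(\<lambda>n. f n x) \<longlonglongrightarrow> lim (\<lambda>n. f n x)" if x: "x \<in> S" for x
  proof -
    have "Cauchy (\<lambda>n. f n x)"
      unfolding Cauchy_altdef2
    proof (intro allI impI)
      fix e :: real assume e: "e > 0"
      have "\<forall>\<^sub>F n in sequentially. 2 * C * (1/2) ^ n < e" using small e order_tendstoD(2) by blast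
      then have "\<forall>\<^sub>F n in sequentially. 2 * C * (1/2) ^ n < e \<and> n \<ge> N"
        by (intro eventually_conj eventually_ge_at_top)
      then obtain n where "2 * C * (1/2) ^ n < e" "n \<ge> N"
        using eventually_happens'[OF sequentially_bot] by blast
      then show "\<exists>n. \<forall>m\<ge>n. dist (f m x) (f n x) < e"
        using b[OF x] by (intro exI[of _ n]) (auto simp: dist_norm intro: le_less_trans)
    qed
    then show ?thesis by (simp add: Cauchy_convergent convergent_LIMSEQ_iff[symmetric])
  qed
  show est: "norm (lim (\<lambda>n. f n x) - f n x) \<le> 2 * C * (1/2) ^ n" if "n \<ge> N" "x \<in> S" for n x
  proof (rule Lim_norm_ubound[OF sequentially_bot])
    show "(\<lambda>m. f m x - f n x) \<longlonglongrightarrow> lim (\<lambda>n. f n x) - f n x"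
      by (intro tendsto_intros conv that)
    show "\<forall>\<^sub>F m in sequentially. norm (f m x - f n x) \<le> 2 * C * (1/2) ^ n"
      using eventually_ge_at_top[of n] by eventually_elim (rule b[OF that(2,1)])
  qed
  show "uniform_limit S f (\<lambda>x. lim (\<lambda>n. f n x)) sequentially"
    unfolding uniform_limit_iff
  proof (intro allI impI)
    fix e :: real assume "e > 0"
    then have "\<forall>\<^sub>F n in sequentially. 2 * C * (1/2) ^ n < e" using small order_tendstoD(2) by blast
    then show "\<forall>\<^sub>F n in sequentially. \<forall>x\<in>S. dist (f n x) (lim (\<lambda>n. f n x)) < e"
      using eventually_ge_at_top[of N]
      by eventually_elim (use est in \<open>auto simp: dist_norm norm_minus_commute intro: le_less_trans\<close>)
  qed
qed

text \<open>The inequality \<open>ln t \<le> t - 1\<close>, applied to \<open>y / x \<le> 2\<close>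
  and to \<open>x / y \<le> 8/3\<close>, bounds the two differences by 1 and 5/3.\<close>

lemma ln_ratio_bound:
  fixes x y :: real
  assumes "x > 0" "y > 0" "y \<le> 2 * x" "3 * x \<le> 8 * y"
  shows "\<bar>ln y - ln x\<bar> \<le> 2"
proof -
  have "ln y - ln x = ln (y / x)" using assms by (simp add: ln_div)
  moreover have "ln (y / x) \<le> y / x - 1" using assms by (intro ln_le_minus_one) simp
  moreover have "y / x \<le> 2" using assms by (simp add: field_simps)
  moreover have "ln x - ln y = ln (x / y)" using assms by (simp add: ln_div)
  moreover have "ln (x / y) \<le> x / y - 1" using assms by (intro ln_le_minus_one) simp
  moreover have "x / y \<le> 8/3" using assms by (simp add: field_simps)
  ultimately show ?thesis by linarith
qed

lemma norm_Ln_le_1: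
  assumes "cmod (z - 1) \<le> 1/16"
  shows "cmod (Ln z) \<le> 1"
proof -
  have "cmod (Ln (1 + (z - 1))) \<le> 2 * cmod (z - 1)" using assms by (intro norm_Ln_le) auto
  then show ?thesis using assms by simp
qed

text \<open>The floor \<open>(1/8) ^ 2 ^ n\<close> regularises \<open>ln (cmod (P n q))\<close> on the zero set of \<open>P n\<close>; it is far below the
  threshold \<open>2 * (1/4) ^ 2 ^ n\<close>, so the perturbation is invisible wherever \<open>P n\<close> exceeds the latter.\<close>

locale fast_henon_sequence = henon_sequence +
  assumes near_square: "\<And>n q. n \<ge> 1 \<Longrightarrow> norm q \<le> real n \<Longrightarrow>
      cmod (P (Suc n) q - (P n q)\<^sup>2) \<le> (1/8) ^ (2 ^ Suc n) / 4"
    and gradient_growth: "\<And>n q. n \<ge> 1 \<Longrightarrow> norm q \<le> real n \<Longrightarrow> 2 * (1/4) ^ (2 ^ n) \<le> cmod (P n q) \<Longrightarrow>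
      2 * (1 - (1/2) ^ Suc n) * norm (G n q) * cmod (P (Suc n) q) \<le> norm (G (Suc n) q) * cmod (P n q)"
    and gradient_nonzero: "G n q \<noteq> 0"
begin

definition V :: "nat \<Rightarrow> C2 \<Rightarrow> real" where
  "V n q = ln (cmod (P n q) + (1/8) ^ (2 ^ n)) / 2 ^ n"

definition U :: "C2 \<Rightarrow> real" where
  "U q = lim (\<lambda>n. V n q)"

text \<open>Passing to the next stage squares the floor \<eta> and almost squares
  \<open>x = cmod (P n q)\<close>. So \<open>y + \<eta>^2\<close> and \<open>(x + \<eta>)^2\<close>
  differ by a bounded factor even where \<open>P n\<close> vanishes, and division by
  \<open>2 ^ Suc n\<close> makes the logarithmic error geometric.\<close>

lemma V_step:
  assumes "n \<ge> 1" "norm q \<le> real n"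
  shows "\<bar>V (Suc n) q - V n q\<bar> \<le> 1 * (1/2) ^ n"
proof -
  define x where "x = cmod (P n q)"
  define \<eta> :: real where "\<eta> = (1/8) ^ (2 ^ n)"
  define y where "y = cmod (P (Suc n) q)"
  have \<eta>: "\<eta> > 0" "\<eta>\<^sup>2 = (1/8) ^ (2 ^ Suc n)" by (auto simp: \<eta>_def power_mult[symmetric] mult.commute)
  have x: "x \<ge> 0" by (simp add: x_def)
  have "\<bar>y - x\<^sup>2\<bar> \<le> cmod (P (Suc n) q - (P n q)\<^sup>2)"
    using norm_triangle_ineq3[of "P (Suc n) q" "(P n q)\<^sup>2"] by (simp add: x_def y_def norm_power)
  also have "\<dots> \<le> \<eta>\<^sup>2 / 4" using near_square[OF assms] \<eta> by simp
  finally have xy: "\<bar>y - x\<^sup>2\<bar> \<le> \<eta>\<^sup>2 / 4" .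
  have sq: "(x + \<eta>)\<^sup>2 = x\<^sup>2 + 2 * (x * \<eta>) + \<eta>\<^sup>2" by (simp add: power2_sum)
  have am: "2 * (x * \<eta>) \<le> x\<^sup>2 + \<eta>\<^sup>2" using sum_squares_bound[of x \<eta>] by simp
  have pos: "0 \<le> x * \<eta>" "0 \<le> x\<^sup>2" "0 < \<eta>\<^sup>2" using x \<eta> by auto
  have "\<bar>ln (y + \<eta>\<^sup>2) - ln ((x + \<eta>)\<^sup>2)\<bar> \<le> 2"
  proof (rule ln_ratio_bound)
    show "0 < (x + \<eta>)\<^sup>2" using x \<eta> by (simp add: add_nonneg_pos)
    show "0 < y + \<eta>\<^sup>2" using \<eta> by (simp add: y_def add_nonneg_pos)
    show "y + \<eta>\<^sup>2 \<le> 2 * (x + \<eta>)\<^sup>2" unfolding sq using xy pos by argo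
    show "3 * (x + \<eta>)\<^sup>2 \<le> 8 * (y + \<eta>\<^sup>2)" unfolding sq using xy am pos by argo
  qed
  moreover have "ln ((x + \<eta>)\<^sup>2) = 2 * ln (x + \<eta>)" using x \<eta> by (simp add: ln_realpow add_nonneg_pos)
  moreover have "V (Suc n) q - V n q = (ln (y + \<eta>\<^sup>2) - 2 * ln (x + \<eta>)) / 2 ^ Suc n"
    unfolding \<eta>(2) by (simp add: V_def x_def y_def \<eta>_def diff_divide_distrib)
  ultimately have "\<bar>V (Suc n) q - V n q\<bar> \<le> 2 / 2 ^ Suc n"
    by (simp add: divide_le_eq)
  then show ?thesis by (simp add: power_divide)
qed

lemma V_uniform_limit: "uniform_limit (cball 0 R) V U sequentially"
proof -
  obtain N :: nat where N: "R \<le> real N" using real_arch_simple by blast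
  have "uniform_limit (cball 0 R) V (\<lambda>q. lim (\<lambda>n. V n q)) sequentially"
  proof (rule uniform_limit_geometric(1)[where N = "max 1 N" and C = 1])
    fix n and q :: C2 assume n: "max 1 N \<le> n" and q: "q \<in> cball 0 R"
    have "norm q \<le> real n" using q N n by (simp add: order_trans[of _ R])
    then show "norm (V (Suc n) q - V n q) \<le> 1 * (1/2) ^ n" using V_step[of n q] n by simp
  qed
  then show ?thesis unfolding U_def[abs_def] .
qed

lemma V_tendsto: "(\<lambda>n. V n q) \<longlonglongrightarrow> U q"
  using tendsto_uniform_limitI[OF V_uniform_limit[of "norm q"], of q] by simp

lemma U_plurisubharmonic: "plurisubharmonic (\<lambda>q. ereal (U q)) \<Omega>"
proof (rule plurisubharmonic_uniform_limit[OF _ V_uniform_limit])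
  fix n
  have pos: "0 < cmod w + (1/8) ^ (2 ^ n)" for w by (simp add: add_nonneg_pos)
  show "continuous_on UNIV (V n)"
    unfolding V_def using pos by (intro continuous_intros P_continuous) (auto simp: less_imp_neq[symmetric])
  fix p b :: C2
  have hol: "(\<lambda>\<zeta>. P n (p + cmul \<zeta> b)) holomorphic_on S" for S
    by (rule sc_holomorphic_on_slice[OF P_sc_holomorphic[OF open_UNIV]]) simp
  have "2*pi * ln (cmod (P n (p + cmul 0 b)) + (1/8) ^ (2 ^ n))
      \<le> integral {0..2*pi} (\<lambda>\<theta>. ln (cmod (P n (p + cmul (cis \<theta>) b)) + (1/8) ^ (2 ^ n)))"
    by (rule sub_mean_ln_norm_plus) (auto intro: hol holomorphic_on_imp_continuous_on)
  then have "2*pi * ln (cmod (P n p) + (1/8) ^ (2 ^ n)) / 2 ^ n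
      \<le> integral {0..2*pi} (\<lambda>\<theta>. ln (cmod (P n (p + cmul (cis \<theta>) b)) + (1/8) ^ (2 ^ n))) / 2 ^ n"
    by (intro divide_right_mono) auto
  then show "2*pi * V n p \<le> integral {0..2*pi} (\<lambda>\<theta>. V n (p + cmul (cis \<theta>) b))"
    by (simp add: V_def)
qed

section \<open>Upper bound and nonconstancy of the limit function\<close>

lemma U_le_0:
  assumes "q \<in> nonautonomous_basin F"
  shows "U q \<le> 0"
proof (rule tendsto_upperbound[OF V_tendsto _ sequentially_bot])
  have "(\<lambda>n. cmod (P n q)) \<longlonglongrightarrow> 0" using assms basin_iff_P tendsto_norm_zero by blast
  then have "\<forall>\<^sub>F n in sequentially. cmod (P n q) < 1/2" by (rule order_tendstoD) simp
  then show "\<forall>\<^sub>F n in sequentially. V n q \<le> 0"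
  proof eventually_elim
    case (elim n)
    have "(1/8::real) ^ (2 ^ n) \<le> (1/8) ^ 1" by (rule power_decreasing) auto
    then have "cmod (P n q) + (1/8) ^ (2 ^ n) \<le> 1" using elim by simp
    then have "ln (cmod (P n q) + (1/8) ^ (2 ^ n)) \<le> 0" by (simp add: add_nonneg_pos)
    then show ?case by (simp add: V_def divide_nonpos_pos)
  qed
qed

lemma U_at_0: "U 0 = ln (1/8)"
proof -
  have "V n 0 = ln (1/8)" for n
    unfolding V_def P_at_0 by (simp add: ln_realpow)
  then show ?thesis using V_tendsto[of 0] by (simp add: LIMSEQ_const_iff)
qed

text \<open>On this real point the recursion adds nonnegative numbers to squares, so
  \<open>P n\<close> dominates its unperturbed value \<open>(1/8) ^ 2 ^ (n - 1)\<close>. Its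
  exponent is half that of the floor, which alone determines \<open>U\<close> at the origin; this
  separates the two values of \<open>U\<close>.\<close>

lemma P_lower_bound: "\<exists>r. P n (1/8, 0) = of_real r \<and> 0 \<le> r \<and> (n \<ge> 1 \<longrightarrow> (1/8) ^ (2 ^ (n - 1)) \<le> r)"
proof (induction n rule: induct_nat_012)
  case 0
  show ?case by (auto simp: P_0 intro!: exI[of _ 0])
next
  case 1
  show ?case by (auto simp: P_1 intro!: exI[of _ "1/8"])
next
  case (ge2 n)
  obtain r where r: "P n (1/8, 0) = of_real r" "0 \<le> r" using ge2(1) by blast
  obtain s where s: "P (Suc n) (1/8, 0) = of_real s" "0 \<le> s" "(1/8) ^ (2 ^ n) \<le> s" using ge2(2) by auto
  have "((1/8) ^ (2 ^ n))\<^sup>2 \<le> s\<^sup>2" by (rule power_mono[OF s(3)]) simp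
  also have "\<dots> \<le> s\<^sup>2 + a n * r" using r(2) a_pos[of n] by simp
  finally have "(1/8) ^ (2 ^ Suc n) \<le> s\<^sup>2 + a n * r" by (simp add: power_mult[symmetric] mult.commute)
  then show ?case
    using r s a_pos[of n] by (intro exI[of _ "s\<^sup>2 + a n * r"]) (auto simp: P_SS)
qed

lemma U_nonconstant: "U (1/8, 0) \<noteq> U 0"
proof -
  have "ln (1/8) / 2 \<le> V (Suc n) (1/8, 0)" for n
  proof -
    obtain r where r: "P (Suc n) (1/8, 0) = of_real r" "0 \<le> r" "(1/8) ^ (2 ^ n) \<le> r"
      using P_lower_bound[of "Suc n"] by auto
    have "(1/8) ^ (2 ^ n) \<le> cmod (P (Suc n) (1/8, 0)) + (1/8) ^ (2 ^ Suc n)" using r by (simp add: add_increasing2)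
    then have "ln ((1/8) ^ (2 ^ n)) \<le> ln (cmod (P (Suc n) (1/8, 0)) + (1/8) ^ (2 ^ Suc n))"
      by (intro ln_mono) auto
    then have "2 ^ n * ln (1/8) \<le> ln (cmod (P (Suc n) (1/8, 0)) + (1/8) ^ (2 ^ Suc n))" by (simp add: ln_realpow)
    then have "2 ^ n * ln (1/8) / 2 ^ Suc n \<le> V (Suc n) (1/8, 0)" unfolding V_def by (intro divide_right_mono) auto
    then show ?thesis by simp
  qed
  then have "ln (1/8) / 2 \<le> U (1/8, 0)"
    by (intro tendsto_lowerbound[OF LIMSEQ_Suc[OF V_tendsto] _ sequentially_bot]) (auto intro!: always_eventually)
  moreover have "ln (1/8::real) < 0" by simp
  ultimately show ?thesis unfolding U_at_0 by linarith
qed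

lemma eighth_in_basin: "(1/8, 0) \<in> nonautonomous_basin F"
proof -
  have "H 0 (1/8, 0) = (1/16, 1/4)" by (simp add: H_def P_SS P_1 P_0 power2_eq_square)
  moreover have "norm (1/16 :: complex, 1/4 :: complex) < 1"
    by (simp add: norm_prod_def power2_eq_square norm_divide real_less_lsqrt)
  ultimately have "(1/8, 0) \<in> H 0 -` ball 0 1" by simp
  then show ?thesis unfolding basin_eq by blast
qed

theorem short_C2_basin: "short_C2 (nonautonomous_basin F)"
  unfolding short_C2_def
proof (intro conjI)
  show "\<exists>W. (\<forall>j. W j \<subseteq> W (Suc j)) \<and> nonautonomous_basin F = (\<Union>j. W j) \<and> (\<forall>j. biholomorphic_to_ball (W j))"
    using H_vimage_mono basin_eq biholomorphic_to_ball_vimage[OF H_automorphism]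
    by (intro exI[of _ "\<lambda>j. H j -` ball 0 1"]) blast
  have "0 \<in> nonautonomous_basin F" unfolding basin_iff_P by (simp add: P_at_0)
  then show "\<exists>u. plurisubharmonic u (nonautonomous_basin F) \<and> (\<exists>M::real. \<forall>z\<in>nonautonomous_basin F. u z \<le> ereal M) \<and>
      (\<exists>z\<in>nonautonomous_basin F. \<exists>w\<in>nonautonomous_basin F. u z \<noteq> u w)"
    using U_plurisubharmonic U_le_0 U_nonconstant eighth_in_basin
    by (intro exI[of _ "\<lambda>q. ereal (U q)"] conjI exI[of _ 0]) auto
qed (use basin_open basin_connected basin_kobayashi in auto)

end

subsection \<open>The boundary of the basin\<close>


context fast_henon_sequence
begin

text \<open>If \<open>cmod (P n q) \<le> 1/2\<close>, two nearly squaring steps with error at most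
  1/32 give the bounds \<open>1/4 + 1/32 = 9/32\<close> and
  \<open>(9/32)^2 + 1/32 = 113/1024\<close>. These place \<open>H n q\<close> in the unit ball,
  hence \<open>q\<close> in the basin.\<close>

lemma notin_basin_imp_large:
  assumes "q \<notin> nonautonomous_basin F" "n \<ge> 1" "norm q \<le> real n"
  shows "cmod (P n q) > 1/2"
proof (rule ccontr)
  assume "\<not> ?thesis"
  then have 0: "cmod (P n q) \<le> 1/2" by simp
  have step: "cmod (P (Suc m) q) \<le> c\<^sup>2 + 1/32" if "m \<ge> 1" "norm q \<le> real m" "cmod (P m q) \<le> c" for m c
  proof -
    have "(1/8::real) ^ (2 ^ Suc m) \<le> (1/8) ^ 1" by (rule power_decreasing) auto
    then have "cmod (P (Suc m) q - (P m q)\<^sup>2) \<le> 1/32" using near_square[OF that(1,2)] by simp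
    moreover have "cmod (P (Suc m) q) \<le> cmod ((P m q)\<^sup>2) + cmod (P (Suc m) q - (P m q)\<^sup>2)"
      by (metis norm_triangle_sub)
    moreover have "cmod ((P m q)\<^sup>2) \<le> c\<^sup>2" unfolding norm_power by (rule power_mono[OF that(3)]) simp
    ultimately show ?thesis by linarith
  qed
  have 1: "cmod (P (Suc n) q) \<le> 9/32"
    using step[OF assms(2,3) 0] by (simp add: power2_eq_square)
  have 2: "cmod (P (Suc (Suc n)) q) \<le> 113/1024"
    using step[of "Suc n", OF _ _ 1] assms(3) by (simp add: power2_eq_square)
  have "(cmod (4 * P (Suc (Suc n)) q))\<^sup>2 \<le> (1/2)\<^sup>2" "(cmod (2 * P (Suc n) q))\<^sup>2 \<le> (9/16)\<^sup>2"
    using 1 2 by (intro power_mono; simp add: norm_mult)+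
  then have "(norm (H n q))\<^sup>2 < 1" by (simp add: H_def norm_prod_def power2_eq_square)
  then have "q \<in> H n -` ball 0 1" by (simp add: power_less_one_iff)
  then show False using assms(1) unfolding basin_eq by blast
qed

text \<open>With \<open>s = (1/4) ^ 2 ^ n\<close> the square of \<open>P n q\<close> has modulus at
  least \<open>4 * s^2\<close>, twice the next threshold, while the perturbation is at most
  \<open>s^2 / 4\<close>. The quotient of these two is the 1/16 in the second claim.\<close>

lemma large_step:
  assumes "n \<ge> 1" "norm q \<le> real n" "2 * (1/4) ^ (2 ^ n) \<le> cmod (P n q)"
  shows "2 * (1/4) ^ (2 ^ Suc n) \<le> cmod (P (Suc n) q)"
    and "cmod (P (Suc n) q / (P n q)\<^sup>2 - 1) \<le> 1/16"
proof -
  define s :: real where "s = (1/4) ^ (2 ^ n)"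
  have s: "s > 0" "(1/4) ^ (2 ^ Suc n) = s\<^sup>2" by (simp_all add: s_def power_mult[symmetric] mult.commute)
  have Ps: "2 * s \<le> cmod (P n q)" using assms(3) by (simp add: s_def)
  have "(2 * s)\<^sup>2 \<le> (cmod (P n q))\<^sup>2" by (rule power_mono[OF Ps]) (use s in simp)
  then have P2: "4 * s\<^sup>2 \<le> cmod ((P n q)\<^sup>2)" by (simp add: norm_power power_mult_distrib)
  have "(1/8::real) ^ (2 ^ Suc n) \<le> (1/4) ^ (2 ^ Suc n)" by (rule power_mono) auto
  then have d: "cmod (P (Suc n) q - (P n q)\<^sup>2) \<le> s\<^sup>2 / 4" 
    using near_square[OF assms(1,2)] unfolding s(2) by linarith
  have "cmod ((P n q)\<^sup>2) \<le> cmod (P (Suc n) q) + cmod (P (Suc n) q - (P n q)\<^sup>2)"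
    by (metis norm_minus_commute norm_triangle_sub)
  then have "2 * s\<^sup>2 \<le> cmod (P (Suc n) q)" using P2 d zero_le_power2[of s] by linarith
  then show "2 * (1/4) ^ (2 ^ Suc n) \<le> cmod (P (Suc n) q)" using s(2) by simp
  have nz: "cmod ((P n q)\<^sup>2) > 0" using P2 s(1) by (meson less_le_trans mult_pos_pos zero_less_numeral zero_less_power)
  then have "P (Suc n) q / (P n q)\<^sup>2 - 1 = (P (Suc n) q - (P n q)\<^sup>2) / (P n q)\<^sup>2" by (simp add: field_simps)
  then have "cmod (P (Suc n) q / (P n q)\<^sup>2 - 1) = cmod (P (Suc n) q - (P n q)\<^sup>2) / cmod ((P n q)\<^sup>2)"
    by (simp add: norm_divide)
  also have "\<dots> \<le> 1/16" using nz d P2 by (simp add: divide_le_eq)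
  finally show "cmod (P (Suc n) q / (P n q)\<^sup>2 - 1) \<le> 1/16" .
qed

lemma large_all:
  assumes "N \<ge> 1" "norm q \<le> real N" "1/2 \<le> cmod (P N q)"
  shows "2 * (1/4) ^ (2 ^ (N + m)) \<le> cmod (P (N + m) q)"
proof (induction m)
  case 0
  have "(1/4::real) ^ (2 ^ N) \<le> (1/4) ^ 1" by (rule power_decreasing) auto
  then show ?case using assms(3) by simp
next
  case (Suc m)
  then show ?case using large_step(1)[of "N + m" q] assms(1,2) by simp
qed

text \<open>The quotients are the norms of the complex gradients of \<open>ln (P n) / 2 ^ n\<close>.
  Each step costs a factor \<open>1 - x/2\<close> with \<open>x = (1/2) ^ k\<close>, and
  \<open>1/2 + x\<close> is an explicit lower bound for the accumulated product:
  \<open>(1/2 + x) * (1 - x/2)\<close> is at least \<open>1/2 + x/2\<close> when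
  \<open>x \<le> 1/2\<close>.\<close>

lemma gradient_ratio_lower_bound:
  assumes "N \<ge> 1" "norm q \<le> real N" "1/2 \<le> cmod (P N q)"
  shows "norm (G N q) / (2 ^ N * cmod (P N q)) * (1/2 + (1/2) ^ (N + m)) \<le> norm (G (N + m) q) / (2 ^ (N + m) * cmod (P (N + m) q))"
proof (induction m)
  case 0
  have "(1/2::real) ^ N \<le> (1/2) ^ 1" using assms(1) by (intro power_decreasing) auto
  then have "norm (G N q) / (2 ^ N * cmod (P N q)) * (1/2 + (1/2) ^ N) \<le> norm (G N q) / (2 ^ N * cmod (P N q))"
    by (intro mult_left_le) auto
  then show ?case by simp
next
  case (Suc m)
  define k where "k = N + m"
  define x :: real where "x = (1/2) ^ k"
  define c where "c = norm (G N q) / (2 ^ N * cmod (P N q))"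
  have c: "c \<ge> 0" by (simp add: c_def)
  have pos: "cmod (P j q) > 0" if "j \<ge> N" for j
  proof -
    have "0 < 2 * (1/4::real) ^ (2 ^ j)" by simp
    also have "\<dots> \<le> cmod (P j q)" using large_all[OF assms, of "j - N"] that by simp
    finally show ?thesis .
  qed
  have k: "k \<ge> 1" "norm q \<le> real k" "k \<ge> N" using assms by (auto simp: k_def)
  have x: "0 < x" "x \<le> 1/2"
  proof -
    have "(1/2::real) ^ k \<le> (1/2) ^ 1" using k(1) by (intro power_decreasing) auto
    then show "x \<le> 1/2" by (simp add: x_def)
  qed (simp add: x_def)
  have "c * (1/2 + x / 2) \<le> c * ((1/2 + x) * (1 - x / 2))"
  proof (rule mult_left_mono[OF _ c])
    have "x * x \<le> x * (1/2)" using x by (intro mult_left_mono) auto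
    then show "1/2 + x / 2 \<le> (1/2 + x) * (1 - x / 2)" by (simp add: algebra_simps)
  qed
  also have "\<dots> = c * (1/2 + x) * (1 - x / 2)" by simp
  also have "\<dots> \<le> norm (G k q) / (2 ^ k * cmod (P k q)) * (1 - x / 2)"
    using Suc x by (intro mult_right_mono) (auto simp: c_def k_def x_def)
  also have "\<dots> \<le> norm (G (Suc k) q) / (2 ^ Suc k * cmod (P (Suc k) q))"
  proof -
    have "2 * (1 - (1/2) ^ Suc k) * norm (G k q) * cmod (P (Suc k) q) \<le> norm (G (Suc k) q) * cmod (P k q)"
      using large_all[OF assms, of m] by (intro gradient_growth k) (simp add: k_def)
    then have "2 * (1 - x / 2) * norm (G k q) * cmod (P (Suc k) q) \<le> norm (G (Suc k) q) * cmod (P k q)"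
      by (simp add: x_def)
    then have "norm (G k q) / cmod (P k q) * (1 - x / 2) \<le> norm (G (Suc k) q) / (2 * cmod (P (Suc k) q))"
      using pos[of k] pos[of "Suc k"] k(3) by (simp add: field_simps)
    then have "norm (G k q) / cmod (P k q) * (1 - x / 2) / 2 ^ k \<le> norm (G (Suc k) q) / (2 * cmod (P (Suc k) q)) / 2 ^ k"
      by (intro divide_right_mono) auto
    then show ?thesis by (simp add: mult_ac)
  qed
  finally show ?case by (simp add: c_def k_def x_def)
qed

lemma basin_smooth_boundary: "smooth_boundary (nonautonomous_basin F)"
  unfolding smooth_boundary_def
proof
  fix p assume "p \<in> frontier (nonautonomous_basin F)"
  then have p: "p \<notin> nonautonomous_basin F" using basin_open by (simp add: frontier_def interior_open)
  obtain N :: nat where N: "norm p + 1 \<le> real N" using real_arch_simple by blast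
  have N1: "N \<ge> 1" using N norm_ge_zero[of p] by linarith
  define p0 where "p0 = P N p"
  have p0: "cmod p0 > 1/2" unfolding p0_def by (rule notin_basin_imp_large[OF p N1]) (use N in simp)
  \<comment> \<open>The radius keeps \<open>P N\<close> at modulus at least 1/2 and
    \<open>P N q / p0\<close> in the right half-plane, where the principal logarithm is
    holomorphic.\<close>
  define W where "W = ball p 1 \<inter> P N -` ball p0 (cmod p0 - 1/2)"
  have oW: "open W"
    unfolding W_def by (intro open_Int open_ball open_vimage P_continuous)
  have pW: "p \<in> W" using p0 by (simp add: W_def p0_def)
  have Wn: "norm q \<le> real N" if "q \<in> W" for q
    using that N norm_triangle_sub[of q p] by (auto simp: W_def dist_norm norm_minus_commute)
  have WP: "cmod (P N q - p0) < cmod p0 - 1/2" if "q \<in> W" for q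
    using that by (simp add: W_def dist_norm norm_minus_commute)
  have Wbig: "1/2 \<le> cmod (P N q)" if "q \<in> W" for q
    using WP[OF that] norm_triangle_sub[of p0 "P N q"] by (simp add: norm_minus_commute)
  have big: "2 * (1/4) ^ (2 ^ (N + m)) \<le> cmod (P (N + m) q)" if "q \<in> W" for q m
    by (rule large_all[OF N1 Wn[OF that] Wbig[OF that]])
  have nz: "P (N + m) q \<noteq> 0" if "q \<in> W" for q m
  proof -
    have "0 < 2 * (1/4::real) ^ (2 ^ (N + m))" by simp
    also have "\<dots> \<le> cmod (P (N + m) q)" by (rule big[OF that])
    finally show ?thesis by simp
  qed
  define R where "R m q = P (Suc (N + m)) q / (P (N + m) q)\<^sup>2" for m q
  have R1: "cmod (R m q - 1) \<le> 1/16" if "q \<in> W" for m q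
    unfolding R_def by (rule large_step(2)) (use big[OF that] Wn[OF that] N1 in auto)
  have Re_pos: "Re z > 0" if "cmod (z - 1) < 1" for z
    using that abs_Re_le_cmod[of "z - 1"] by auto
  have RRe: "Re (R m q) > 0" if "q \<in> W" for m q
    by (rule Re_pos) (use R1[OF that, of m] in simp)
  have Q0: "Re (P N q / p0) > 0" if "q \<in> W" for q
  proof (rule Re_pos)
    have "p0 \<noteq> 0" using p0 by auto
    then have "P N q / p0 - 1 = (P N q - p0) / p0" by (simp add: field_simps)
    then have "cmod (P N q / p0 - 1) = cmod (P N q - p0) / cmod p0" by (simp only: norm_divide)
    also have "\<dots> < 1" using WP[OF that] p0 by (simp add: divide_less_eq)
    finally show "cmod (P N q / p0 - 1) < 1" .
  qed
  \<comment> \<open>This is a branch of \<open>ln (P (N + m)) / 2 ^ (N + m)\<close>. Only the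
    logarithm at level \<open>N\<close> needs a choice of branch, made relative to
    \<open>p0\<close>; each later level adds the principal logarithm of a ratio close to 1.\<close>
  define h where "h m q = (Ln (P N q / p0) + of_real (ln (cmod p0)) + \<i> * of_real (Arg p0)) / 2 ^ N +
      (\<Sum>j<m. Ln (R j q) / 2 ^ Suc (N + j))" for m q
  have hSuc: "h (Suc m) q = h m q + Ln (R m q) / 2 ^ Suc (N + m)" for m q by (simp add: h_def)
  have exp_h: "exp (2 ^ (N + m) * h m q) = P (N + m) q" if q: "q \<in> W" for m q
  proof (induction m)
    case 0
    have "p0 \<noteq> 0" using p0 by auto
    have "exp (2 ^ N * h 0 q) = exp (Ln (P N q / p0)) * exp (Ln p0)"
      using \<open>p0 \<noteq> 0\<close> by (simp add: h_def exp_add[symmetric] Ln_Arg add.assoc)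
    also have "\<dots> = P N q" using nz[OF q, of 0] \<open>p0 \<noteq> 0\<close> by simp
    finally show ?case by simp
  next
    case (Suc m)
    have "2 ^ (N + Suc m) * h (Suc m) q = of_nat 2 * (2 ^ (N + m) * h m q) + Ln (R m q)"
      unfolding hSuc by (simp add: field_simps)
    then have "exp (2 ^ (N + Suc m) * h (Suc m) q) = exp (2 ^ (N + m) * h m q) ^ 2 * exp (Ln (R m q))"
      by (simp only: exp_add exp_of_nat_mult)
    also have "\<dots> = (P (N + m) q)\<^sup>2 * R m q"
      using Suc RRe[OF q, of m] by (subst exp_Ln) auto
    also have "\<dots> = P (N + Suc m) q" using nz[OF q, of m] by (simp add: R_def)
    finally show ?case .
  qed
  have Re_h: "Re (h m q) = ln (cmod (P (N + m) q)) / 2 ^ (N + m)" if "q \<in> W" for m q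
  proof -
    have "cmod (P (N + m) q) = exp (2 ^ (N + m) * Re (h m q))"
      using exp_h[OF that, of m, symmetric] by (simp del: of_real_power add: Re_power_real norm_exp_eq_Re)
    then show ?thesis by simp
  qed
  have sc_Ln: "sc_holomorphic_on (\<lambda>q. Ln (f q)) W" if "sc_holomorphic_on f W" "\<And>q. q \<in> W \<Longrightarrow> Re (f q) > 0" for f
  proof (rule sc_holomorphic_on_compose[OF that(1)])
    show "Ln holomorphic_on {z. 0 < Re z}"
      by (intro holomorphic_on_Ln) (auto simp: complex_nonpos_Reals_iff)
    show "open {z. 0 < Re z}" by (rule open_halfspace_Re_gt)
  qed (use that(2) in auto)
  have sc_R: "sc_holomorphic_on (R m) W" for m
  proof -
    have "sc_holomorphic_on (\<lambda>q. inverse ((P (N + m) q) * (P (N + m) q))) W"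
      by (rule sc_holomorphic_on_compose[where S = "- {0}"])
        (use nz in \<open>auto intro!: sc_holomorphic_on_mult P_sc_holomorphic oW holomorphic_on_inverse\<close>)
    then have "sc_holomorphic_on (\<lambda>q. P (Suc (N + m)) q * inverse ((P (N + m) q) * (P (N + m) q))) W"
      by (intro sc_holomorphic_on_mult P_sc_holomorphic oW)
    then show ?thesis unfolding R_def[abs_def] by (simp add: divide_inverse power2_eq_square)
  qed
  have sc_h: "sc_holomorphic_on (h m) W" for m
  proof (induction m)
    case 0
    have "sc_holomorphic_on (\<lambda>q. Ln (P N q * (1 / p0))) W"
    proof (rule sc_Ln)
      show "sc_holomorphic_on (\<lambda>q. P N q * (1 / p0)) W"
        by (intro sc_holomorphic_on_mult P_sc_holomorphic sc_holomorphic_on_const oW)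
    qed (use Q0 in simp)
    then have "sc_holomorphic_on (\<lambda>q. (Ln (P N q * (1 / p0)) + (of_real (ln (cmod p0)) + \<i> * of_real (Arg p0))) * (1 / 2 ^ N)) W"
      by (intro sc_holomorphic_on_mult sc_holomorphic_on_add sc_holomorphic_on_const oW)
    then show ?case unfolding h_def[abs_def] by (simp add: add.assoc)
  next
    case (Suc m)
    have "sc_holomorphic_on (\<lambda>q. h m q + Ln (R m q) * (1 / 2 ^ Suc (N + m))) W"
      by (intro sc_holomorphic_on_add sc_holomorphic_on_mult Suc sc_Ln sc_R RRe sc_holomorphic_on_const oW)
    moreover have "h (Suc m) = (\<lambda>q. h m q + Ln (R m q) * (1 / 2 ^ Suc (N + m)))"
      by (rule ext) (simp add: hSuc)
    ultimately show ?case by (simp only:)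
  qed
  have h_step: "norm (h (Suc m) q - h m q) \<le> (1/2) ^ N * (1/2) ^ m" if "q \<in> W" for m q
  proof -
    have "norm (h (Suc m) q - h m q) = cmod (Ln (R m q)) / 2 ^ Suc (N + m)"
      by (simp add: hSuc norm_divide norm_mult norm_power)
    also have "\<dots> \<le> 1 / 2 ^ (N + m)"
      using norm_Ln_le_1[OF R1[OF that, of m]] by (intro frac_le) auto
    finally show ?thesis by (simp add: power_add power_divide)
  qed
  define f where "f q = lim (\<lambda>m. h m q)" for q
  have f_lim: "uniform_limit W h f sequentially"
    unfolding f_def[abs_def] by (rule uniform_limit_geometric(1)[where N = 0]) (rule h_step)
  have f_est: "norm (f q - h m q) \<le> 2 * (1/2) ^ (N + m)" if "q \<in> W" for m q
    using uniform_limit_geometric(2)[where N = 0, of W h, OF h_step _ that, of m] by (simp add: f_def power_add)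
  have f_sc: "sc_holomorphic_on f W" by (rule sc_holomorphic_on_uniform_limit(1)[OF sc_h f_lim])
  \<comment> \<open>On the basin \<open>cmod (P (N + m) q)\<close> drops below
    \<open>exp (- 2)\<close>, which beats the error \<open>2 / 2 ^ (N + m)\<close> between
    \<open>f\<close> and \<open>h m\<close>. Off the basin it stays above 1/2, so the lower bound
    for \<open>Re (h m q)\<close> tends to 0.\<close>
  have sign: "q \<in> nonautonomous_basin F \<longleftrightarrow> Re (f q) < 0" if q: "q \<in> W" for q
  proof
    assume "q \<in> nonautonomous_basin F"
    then have "(\<lambda>n. P n q) \<longlonglongrightarrow> 0" by (simp add: basin_iff_P)
    then have "(\<lambda>m. P (m + N) q) \<longlonglongrightarrow> 0" by (rule LIMSEQ_ignore_initial_segment)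
    then have "(\<lambda>m. cmod (P (m + N) q)) \<longlonglongrightarrow> 0" by (rule tendsto_norm_zero)
    then have "\<forall>\<^sub>F m in sequentially. cmod (P (m + N) q) < exp (- 2)" by (rule order_tendstoD) simp
    then obtain m where "cmod (P (m + N) q) < exp (- 2)" using eventually_happens'[OF sequentially_bot] by blast
    then have "ln (cmod (P (N + m) q)) < ln (exp (- 2))"
      using nz[OF q, of m] by (subst ln_less_cancel_iff) (simp_all add: add.commute)
    then have "Re (h m q) < - 2 / 2 ^ (N + m)" unfolding Re_h[OF q] by (intro divide_strict_right_mono) auto
    moreover have "Re (f q - h m q) \<le> 2 / 2 ^ (N + m)"
      using f_est[OF q, of m] complex_Re_le_cmod[of "f q - h m q"] by (simp add: power_divide)
    ultimately show "Re (f q) < 0" by simp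
  next
    assume neg: "Re (f q) < 0"
    show "q \<in> nonautonomous_basin F"
    proof (rule ccontr)
      assume "q \<notin> nonautonomous_basin F"
      then have "1/2 < cmod (P (N + m) q)" for m
        by (rule notin_basin_imp_large) (use N1 Wn[OF q] in auto)
      then have "ln (1/2) / 2 ^ (N + m) \<le> Re (h m q)" for m
        unfolding Re_h[OF q] by (intro divide_right_mono ln_mono) (auto intro: less_imp_le)
      moreover have "(\<lambda>m. Re (h m q)) \<longlonglongrightarrow> Re (f q)"
        by (intro tendsto_Re tendsto_uniform_limitI[OF f_lim q])
      moreover have "(\<lambda>m. ln (1/2) / 2 ^ (N + m) :: real) \<longlonglongrightarrow> 0" by real_asymp
      ultimately have "0 \<le> Re (f q)" by (intro LIMSEQ_le[of _ 0 "\<lambda>m. Re (h m q)"]) auto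
      then show False using neg by simp
    qed
  qed
  \<comment> \<open>Differentiating \<open>exp_h\<close> yields the logarithmic derivative without
    differentiating the sum that defines \<open>h\<close>.\<close>
  have dir_h: "dir_deriv v (h m) q = (fst (G (N + m) q) * fst v + snd (G (N + m) q) * snd v) / (2 ^ (N + m) * P (N + m) q)"
    if q: "q \<in> W" for m q v
  proof -
    have "((\<lambda>\<zeta>. h m (q + cmul \<zeta> v)) has_field_derivative dir_deriv v (h m) q) (at 0)"
      using sc_h[of m] q unfolding dir_deriv_def sc_holomorphic_on_def by (simp add: field_differentiable_derivI)
    then have 1: "((\<lambda>\<zeta>. exp (2 ^ (N + m) * h m (q + cmul \<zeta> v))) has_field_derivative
        exp (2 ^ (N + m) * h m q) * (2 ^ (N + m) * dir_deriv v (h m) q)) (at 0)"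
      by (auto intro!: derivative_eq_intros)
    obtain r where r: "r > 0" "\<And>\<zeta>. \<zeta> \<in> cball 0 r \<Longrightarrow> q + cmul \<zeta> v \<in> W"
      using slice_in_open[OF oW q] by metis
    have 2: "((\<lambda>\<zeta>. P (N + m) (q + cmul \<zeta> v)) has_field_derivative
        exp (2 ^ (N + m) * h m q) * (2 ^ (N + m) * dir_deriv v (h m) q)) (at 0)"
      by (rule has_field_derivative_transform_within_open[OF 1 open_ball[of 0 r]]) (use r exp_h in auto)
    have 3: "((\<lambda>\<zeta>. P (N + m) (q + cmul \<zeta> v)) has_field_derivative
        fst (G (N + m) q) * fst v + snd (G (N + m) q) * snd v) (at 0)"
      using P_line_derivative[of "N + m" q v 0] by simp
    show ?thesis using DERIV_unique[OF 2 3, unfolded exp_h[OF q]] nz[OF q, of m] by (simp add: field_simps)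
  qed
  \<comment> \<open>A vanishing real differential forces the complex one to vanish, by testing
    \<open>v\<close> and \<open>cmul \<i> v\<close>. But the gradients of \<open>h m\<close>
    converge to that of \<open>f\<close> and keep norm at least \<open>c / 2\<close>.\<close>
  have nondeg: "frechet_derivative (\<lambda>q. Re (f q)) (at z) \<noteq> (\<lambda>_. 0)" if z: "z \<in> W" for z
  proof
    assume "frechet_derivative (\<lambda>q. Re (f q)) (at z) = (\<lambda>_. 0)"
    then have Re0: "Re (dir_deriv v f z) = 0" for v
      using frechet_derivative_Re_sc_holomorphic(2)[OF f_sc z] by metis
    have dir0: "dir_deriv v f z = 0" for v
      using Re0[of v] Re0[of "cmul \<i> v"] dir_deriv_cmul[OF f_sc z, of \<i> v] by (simp add: complex_eq_iff)
    have "(\<lambda>m. (dir_deriv (1, 0) (h m) z, dir_deriv (0, 1) (h m) z)) \<longlonglongrightarrow> (dir_deriv (1, 0) f z, dir_deriv (0, 1) f z)"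
      by (intro tendsto_Pair sc_holomorphic_on_uniform_limit(2)[OF sc_h f_lim z])
    from tendsto_norm[OF this]
    have lim: "(\<lambda>m. norm (dir_deriv (1, 0) (h m) z, dir_deriv (0, 1) (h m) z)) \<longlonglongrightarrow> 0"
      by (simp add: dir0 zero_prod_def[symmetric])
    define c where "c = norm (G N z) / (2 ^ N * cmod (P N z))"
    have c: "c > 0" using gradient_nonzero[of N z] nz[OF z, of 0] by (simp add: c_def)
    have "c / 2 \<le> norm (dir_deriv (1, 0) (h m) z, dir_deriv (0, 1) (h m) z)" for m
    proof -
      have "(dir_deriv (1, 0) (h m) z, dir_deriv (0, 1) (h m) z) = cmul (1 / (2 ^ (N + m) * P (N + m) z)) (G (N + m) z)"
        by (simp add: dir_h[OF z] cmul_def)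
      then have "norm (dir_deriv (1, 0) (h m) z, dir_deriv (0, 1) (h m) z) = norm (G (N + m) z) / (2 ^ (N + m) * cmod (P (N + m) z))"
        by (simp add: norm_cmul norm_divide norm_mult norm_power)
      moreover have "c * (1/2) \<le> c * (1/2 + (1/2) ^ (N + m))" using c by (intro mult_left_mono) auto
      ultimately show ?thesis
        using gradient_ratio_lower_bound[OF N1 Wn[OF z] Wbig[OF z], of m] unfolding c_def[symmetric] by linarith
    qed
    then have "c / 2 \<le> 0" by (intro LIMSEQ_le_const[OF lim]) auto
    then show False using c by simp
  qed
  show "\<exists>U \<rho>. open U \<and> p \<in> U \<and> (\<forall>k. Ck_on k \<rho> U) \<and>
      nonautonomous_basin F \<inter> U = {z\<in>U. \<rho> z < 0} \<and> (\<forall>z\<in>U. frechet_derivative \<rho> (at z) \<noteq> (\<lambda>_. 0))"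
  proof (intro exI conjI)
    show "nonautonomous_basin F \<inter> W = {z\<in>W. Re (f z) < 0}" using sign by auto
    show "\<forall>k. Ck_on k (\<lambda>q. Re (f q)) W" using Ck_on_Re_sc_holomorphic[OF f_sc] by blast
    show "\<forall>z\<in>W. frechet_derivative (\<lambda>q. Re (f q)) (at z) \<noteq> (\<lambda>_. 0)" using nondeg by blast
  qed (use oW pW in auto)
qed

end

subsection \<open>Choice of the coefficients\<close>


text \<open>At \<open>a = 0\<close> the second inequality holds with the gap
  \<open>2 * \<tau> * norm (Dg q) * (cmod (g q))^2\<close>, which compactness and the threshold
  \<open>t\<close> keep above a positive constant. A small \<open>a\<close> uses up only part of
  it.\<close>

lemma exists_small_coefficient:
  fixes f g :: "C2 \<Rightarrow> complex" and Df Dg :: "C2 \<Rightarrow> C2" and k :: nat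
  assumes cont: "continuous_on UNIV f" "continuous_on UNIV g" "continuous_on UNIV Df" "continuous_on UNIV Dg"
    and nz: "\<And>q. Dg q \<noteq> 0" and pos: "\<epsilon> > 0" "t > 0" "\<tau> > 0" "\<tau> < 1"
  shows "\<exists>a>0. a \<le> 1/16 \<and> (\<forall>q. norm q \<le> real k \<longrightarrow> a * cmod (f q) \<le> \<epsilon> \<and>
     (t \<le> cmod (g q) \<longrightarrow> 2 * (1 - \<tau>) * norm (Dg q) * cmod ((g q)\<^sup>2 + of_real a * f q)
        \<le> norm (cmul (2 * g q) (Dg q) + cmul (of_real a) (Df q)) * cmod (g q)))"
proof -
  define K :: "C2 set" where "K = cball 0 (real k)"
  have K: "compact K" "K \<noteq> {}" by (auto simp: K_def)
  have bd: "\<exists>B. \<forall>q\<in>K. norm (h q) \<le> B" if "continuous_on UNIV h" for h :: "C2 \<Rightarrow> 'b::real_normed_vector"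
  proof -
    have "bounded (h ` K)" by (intro compact_imp_bounded compact_continuous_image K continuous_on_subset[OF that]) simp
    then show ?thesis unfolding bounded_iff by blast
  qed
  obtain B1 B2 B3 B4 where B': "\<forall>q\<in>K. cmod (f q) \<le> B1" "\<forall>q\<in>K. cmod (g q) \<le> B2"
    "\<forall>q\<in>K. norm (Df q) \<le> B3" "\<forall>q\<in>K. norm (Dg q) \<le> B4"
    using bd[OF cont(1)] bd[OF cont(2)] bd[OF cont(3)] bd[OF cont(4)] by blast
  define B where "B = Max {1, B1, B2, B3, B4}"
  have Bge: "1 \<le> B" "B1 \<le> B" "B2 \<le> B" "B3 \<le> B" "B4 \<le> B" unfolding B_def by (auto intro: Max_ge)
  have B: "cmod (f q) \<le> B" "cmod (g q) \<le> B" "norm (Df q) \<le> B" "norm (Dg q) \<le> B" if "q \<in> K" for q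
    using B' Bge that by (meson order_trans)+
  have "continuous_on K (\<lambda>q. norm (Dg q))" using cont(4) continuous_on_subset continuous_on_norm by blast
  then obtain q0 where q0: "q0 \<in> K" "\<And>q. q \<in> K \<Longrightarrow> norm (Dg q0) \<le> norm (Dg q)"
    using continuous_attains_inf[OF K] by blast
  define m where "m = norm (Dg q0)"
  have m: "m > 0" "\<And>q. q \<in> K \<Longrightarrow> m \<le> norm (Dg q)" using nz q0 by (auto simp: m_def)
  \<comment> \<open>The last entry balances the gap \<open>2 * \<tau> * m * t^2\<close> against the
    total perturbation, which is at most \<open>3 * a * B^2\<close>: twice \<open>a * B^2\<close>
    from the enlarged left side and once from the reduced gradient.\<close>
  define a where "a = Min {1/16, \<epsilon> / B, 2 * \<tau> * m * t\<^sup>2 / (3 * B\<^sup>2)}"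
  have a0: "a > 0" using Bge(1) pos m(1) by (simp add: a_def)
  have ale: "a \<le> 1/16" "a \<le> \<epsilon> / B" "a \<le> 2 * \<tau> * m * t\<^sup>2 / (3 * B\<^sup>2)" 
    unfolding a_def by (intro Min_le; simp)+
  have aB: "a * B \<le> \<epsilon>" using ale(2) Bge(1) by (simp add: field_simps)
  have aB2: "3 * a * B\<^sup>2 \<le> 2 * \<tau> * m * t\<^sup>2" using ale(3) Bge(1) by (simp add: field_simps)
  have est1: "a * cmod (f q) \<le> \<epsilon>" if "q \<in> K" for q
    using mult_left_mono[OF B(1)[OF that] less_imp_le[OF a0]] aB by (rule order_trans)
  have est2: "2 * (1 - \<tau>) * norm (Dg q) * cmod ((g q)\<^sup>2 + of_real a * f q)
        \<le> norm (cmul (2 * g q) (Dg q) + cmul (of_real a) (Df q)) * cmod (g q)"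
    if q: "q \<in> K" and t: "t \<le> cmod (g q)" for q
  proof -
    define x where "x = cmod (g q)"
    define y where "y = norm (Dg q)"
    have x: "0 < x" "t \<le> x" "x \<le> B" using t pos B(2)[OF q] by (auto simp: x_def)
    have y: "0 < y" "m \<le> y" "y \<le> B" using m(1) m(2)[OF q] B(4)[OF q] by (auto simp: y_def)
    have aB0: "0 \<le> a * B" using a0 Bge(1) by simp
    have 1: "cmod ((g q)\<^sup>2 + of_real a * f q) \<le> x\<^sup>2 + a * B"
    proof -
      have "cmod ((g q)\<^sup>2 + of_real a * f q) \<le> x\<^sup>2 + a * cmod (f q)"
        using norm_triangle_ineq[of "(g q)\<^sup>2" "of_real a * f q"] a0 by (simp add: norm_power norm_mult x_def)
      then show ?thesis using mult_left_mono[OF B(1)[OF q] less_imp_le[OF a0]] by linarith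
    qed
    have "norm (cmul (2 * g q) (Dg q)) \<le> norm (cmul (2 * g q) (Dg q) + cmul (of_real a) (Df q)) + norm (cmul (of_real a) (Df q))"
      by (metis add_diff_cancel_right' norm_triangle_ineq4)
    then have "2 * x * y - a * norm (Df q) \<le> norm (cmul (2 * g q) (Dg q) + cmul (of_real a) (Df q))"
      using a0 by (simp add: norm_cmul norm_mult x_def y_def)
    then have 2: "2 * x * y - a * B \<le> norm (cmul (2 * g q) (Dg q) + cmul (of_real a) (Df q))"
      using mult_left_mono[OF B(3)[OF q] less_imp_le[OF a0]] by linarith
    have "m * t\<^sup>2 \<le> y * x\<^sup>2" using x y pos m by (intro mult_mono power_mono) auto
    then have "2 * \<tau> * (m * t\<^sup>2) \<le> 2 * \<tau> * (y * x\<^sup>2)" using pos by (intro mult_left_mono) auto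
    then have 3: "3 * a * B\<^sup>2 \<le> 2 * \<tau> * (y * x\<^sup>2)" using aB2 by (simp add: mult.assoc)
    have "2 * (1 - \<tau>) * y * cmod ((g q)\<^sup>2 + of_real a * f q) \<le> 2 * (1 - \<tau>) * y * (x\<^sup>2 + a * B)"
      using 1 pos y by (intro mult_left_mono) auto
    also have "\<dots> \<le> (2 * x * y - a * B) * x"
    proof -
      have "(1 - \<tau>) * y * (a * B) \<le> 1 * B * (a * B)" using pos y aB0 a0 by (intro mult_mono) auto
      moreover have "(a * B) * x \<le> (a * B) * B" using x aB0 by (intro mult_left_mono) auto
      ultimately have "2 * ((1 - \<tau>) * y * (a * B)) + (a * B) * x \<le> 3 * (B * (a * B))" by (simp only: mult_1_left mult.commute[of "a * B" B])
      then have "2 * ((1 - \<tau>) * y * (a * B)) + (a * B) * x \<le> 3 * a * B\<^sup>2" by (simp add: power2_eq_square mult_ac)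
      then have "2 * ((1 - \<tau>) * y * (a * B)) + (a * B) * x \<le> 2 * \<tau> * (y * x\<^sup>2)" using 3 by linarith
      then show ?thesis by (simp add: algebra_simps power2_eq_square)
    qed
    also have "\<dots> \<le> norm (cmul (2 * g q) (Dg q) + cmul (of_real a) (Df q)) * x"
      using 2 x by (intro mult_right_mono) auto
    finally show ?thesis by (simp add: x_def y_def)
  qed
  show ?thesis using a0 ale(1) est1 est2 by (intro exI[of _ a]) (auto simp: K_def)
qed

text \<open>A state collects two consecutive polynomials and their gradients. The determinant condition
  is preserved because the determinant is multiplied by the nonzero coefficient, up to sign.\<close>

type_synonym henon_state = "(C2 \<Rightarrow> complex) \<times> (C2 \<Rightarrow> complex) \<times> (C2 \<Rightarrow> C2) \<times> (C2 \<Rightarrow> C2)"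

definition good_state :: "henon_state \<Rightarrow> bool" where
  "good_state = (\<lambda>(f, g, Df, Dg). continuous_on UNIV f \<and> continuous_on UNIV g \<and>
     continuous_on UNIV Df \<and> continuous_on UNIV Dg \<and>
     (\<forall>q. fst (Df q) * snd (Dg q) \<noteq> snd (Df q) * fst (Dg q)))"

definition next_state :: "real \<Rightarrow> henon_state \<Rightarrow> henon_state" where
  "next_state a = (\<lambda>(f, g, Df, Dg). (g, \<lambda>q. (g q)\<^sup>2 + of_real a * f q,
     Dg, \<lambda>q. cmul (2 * g q) (Dg q) + cmul (of_real a) (Df q)))"

text \<open>State \<open>n\<close> holds \<open>P n\<close> and \<open>P (Suc n)\<close>, and its
  coefficient produces \<open>P (Suc (Suc n))\<close>; hence these are the estimates
  \<open>near_square\<close> and \<open>gradient_growth\<close> at index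
  \<open>Suc n\<close>.\<close>

definition good_coefficient :: "nat \<Rightarrow> henon_state \<Rightarrow> real \<Rightarrow> bool" where
  "good_coefficient n = (\<lambda>(f, g, Df, Dg) a. 0 < a \<and> a \<le> 1/16 \<and>
     (\<forall>q. norm q \<le> real (Suc n) \<longrightarrow> a * cmod (f q) \<le> (1/8) ^ (2 ^ Suc (Suc n)) / 4 \<and>
       (2 * (1/4) ^ (2 ^ Suc n) \<le> cmod (g q) \<longrightarrow>
          2 * (1 - (1/2) ^ Suc (Suc n)) * norm (Dg q) * cmod ((g q)\<^sup>2 + of_real a * f q)
            \<le> norm (cmul (2 * g q) (Dg q) + cmul (of_real a) (Df q)) * cmod (g q))))"

lemma good_coefficient_exists:
  assumes "good_state s"
  shows "\<exists>a. good_coefficient n s a"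
proof -
  obtain f g Df Dg where s: "s = (f, g, Df, Dg)" by (metis prod.exhaust)
  have st: "continuous_on UNIV f" "continuous_on UNIV g" "continuous_on UNIV Df" "continuous_on UNIV Dg"
    "\<And>q. fst (Df q) * snd (Dg q) \<noteq> snd (Df q) * fst (Dg q)"
    using assms by (auto simp: s good_state_def)
  have "Dg q \<noteq> 0" for q using st(5)[of q] by auto
  then show ?thesis
    using exists_small_coefficient[OF st(1-4), of "(1/8) ^ (2 ^ Suc (Suc n)) / 4" "2 * (1/4) ^ (2 ^ Suc n)" "(1/2) ^ Suc (Suc n)" "Suc n"]
    unfolding s good_coefficient_def prod.case by (auto simp: power_less_one_iff simp del: power_Suc)
qed

lemma good_state_next:
  assumes "good_state s" "a \<noteq> 0"
  shows "good_state (next_state a s)"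
proof -
  obtain f g Df Dg where s: "s = (f, g, Df, Dg)" by (metis prod.exhaust)
  have st: "continuous_on UNIV f" "continuous_on UNIV g" "continuous_on UNIV Df" "continuous_on UNIV Dg"
    "\<And>q. fst (Df q) * snd (Dg q) \<noteq> snd (Df q) * fst (Dg q)"
    using assms by (auto simp: s good_state_def)
  have "fst (Dg q) * snd (cmul (2 * g q) (Dg q) + cmul (of_real a) (Df q)) \<noteq>
      snd (Dg q) * fst (cmul (2 * g q) (Dg q) + cmul (of_real a) (Df q))" for q
  proof
    assume "fst (Dg q) * snd (cmul (2 * g q) (Dg q) + cmul (of_real a) (Df q)) =
      snd (Dg q) * fst (cmul (2 * g q) (Dg q) + cmul (of_real a) (Df q))"
    then have "of_real a * (fst (Df q) * snd (Dg q)) = of_real a * (snd (Df q) * fst (Dg q))"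
      unfolding cmul_def fst_add snd_add fst_conv snd_conv by algebra
    then show False using st(5)[of q] assms(2) by simp
  qed
  moreover have "continuous_on UNIV (\<lambda>q. cmul (2 * g q) (Dg q) + cmul (of_real a) (Df q))"
    unfolding cmul_def using st by (intro continuous_intros)
  moreover have "continuous_on UNIV (\<lambda>q. (g q)\<^sup>2 + of_real a * f q)"
    using st by (intro continuous_intros)
  ultimately show ?thesis using st by (simp add: s good_state_def next_state_def)
qed

lemma fast_henon_sequence_exists: "\<exists>a P G. fast_henon_sequence a P G"
proof -
  define s0 :: henon_state where "s0 = (snd, fst, \<lambda>_. (0, 1), \<lambda>_. (1, 0))"
  have s0: "good_state s0"
    by (auto simp: s0_def good_state_def intro!: continuous_intros)
  obtain S where S: "\<And>n. good_state (S n) \<and> (n = 0 \<longrightarrow> S n = s0)"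
    "\<And>n. \<exists>a. good_coefficient n (S n) a \<and> S (Suc n) = next_state a (S n)"
  proof -
    \<comment> \<open>Each coefficient depends on the state reached so far, so the states are built
      by dependent choice; the clause for \<open>n = 0\<close> fixes the starting state.\<close>
    have "\<exists>S. \<forall>n. (good_state (S n) \<and> (n = 0 \<longrightarrow> S n = s0)) \<and>
        (\<exists>a. good_coefficient n (S n) a \<and> S (Suc n) = next_state a (S n))"
    proof (rule dependent_nat_choice)
      show "\<exists>s. good_state s \<and> (0 = (0::nat) \<longrightarrow> s = s0)" using s0 by blast
      fix s and n :: nat assume "good_state s \<and> (n = 0 \<longrightarrow> s = s0)"
      then have s: "good_state s" by blast
      obtain a where a: "good_coefficient n s a" using good_coefficient_exists[OF s] by blast
      then have "a \<noteq> 0" by (auto simp: good_coefficient_def split: prod.splits)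
      then show "\<exists>s'. (good_state s' \<and> (Suc n = 0 \<longrightarrow> s' = s0)) \<and> (\<exists>a. good_coefficient n s a \<and> s' = next_state a s)"
        using good_state_next[OF s] a by blast
    qed
    then show ?thesis using that by blast
  qed
  obtain a where a: "\<And>n. good_coefficient n (S n) (a n)" "\<And>n. S (Suc n) = next_state (a n) (S n)"
    using S(2) by metis
  define P where "P n = fst (S n)" for n
  define G where "G n = fst (snd (snd (S n)))" for n
  have Sn: "S n = (P n, P (Suc n), G n, G (Suc n))" for n
    unfolding P_def G_def a(2) next_state_def by (simp add: case_prod_unfold)
  have step: "P (Suc (Suc n)) = (\<lambda>q. (P (Suc n) q)\<^sup>2 + of_real (a n) * P n q)"
      "G (Suc (Suc n)) = (\<lambda>q. cmul (2 * P (Suc n) q) (G (Suc n) q) + cmul (of_real (a n)) (G n q))" for n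
    using a(2)[of n] unfolding Sn next_state_def by auto
  have init: "P 0 = snd" "P (Suc 0) = fst" "G 0 = (\<lambda>_. (0, 1))" "G (Suc 0) = (\<lambda>_. (1, 0))"
    using S(1)[of 0] unfolding Sn s0_def by auto
  have good: "0 < a n" "a n \<le> 1/16"
    "\<And>q. norm q \<le> real (Suc n) \<Longrightarrow> a n * cmod (P n q) \<le> (1/8) ^ (2 ^ Suc (Suc n)) / 4"
    "\<And>q. norm q \<le> real (Suc n) \<Longrightarrow> 2 * (1/4) ^ (2 ^ Suc n) \<le> cmod (P (Suc n) q) \<Longrightarrow>
      2 * (1 - (1/2) ^ Suc (Suc n)) * norm (G (Suc n) q) * cmod (P (Suc (Suc n)) q) \<le> norm (G (Suc (Suc n)) q) * cmod (P (Suc n) q)" for n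
    using a(1)[of n] unfolding Sn good_coefficient_def prod.case step by blast+
  have "fast_henon_sequence a P G"
  proof (unfold_locales)
    show "cmod (P (Suc n) q - (P n q)\<^sup>2) \<le> (1/8) ^ (2 ^ Suc n) / 4" if n: "n \<ge> 1" "norm q \<le> real n" for n q
    proof -
      \<comment> \<open>\<open>P (Suc n)\<close> arises from \<open>P n\<close> through the
        coefficient with index \<open>n - 1\<close>, which is why the estimates start at 1.\<close>
      obtain k where k: "n = Suc k" using n(1) by (cases n) auto
      have "cmod (P (Suc n) q - (P n q)\<^sup>2) = a k * cmod (P k q)"
        unfolding k step(1)[of k] using good(1)[of k] by (simp add: norm_mult)
      then show ?thesis using good(3)[of q k] n(2) unfolding k by simp
    qed
    show "2 * (1 - (1/2) ^ Suc n) * norm (G n q) * cmod (P (Suc n) q) \<le> norm (G (Suc n) q) * cmod (P n q)"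
      if n: "n \<ge> 1" "norm q \<le> real n" "2 * (1/4) ^ (2 ^ n) \<le> cmod (P n q)" for n q
    proof -
      obtain k where k: "n = Suc k" using n(1) by (cases n) auto
      show ?thesis using good(4)[of q k] n(2,3) unfolding k by blast
    qed
    show "G n q \<noteq> 0" for n q
    proof -
      have "fst (G n q) * snd (G (Suc n) q) \<noteq> snd (G n q) * fst (G (Suc n) q)"
        using S(1)[of n] unfolding Sn good_state_def prod.case by blast
      then show ?thesis by auto
    qed
    show "a n \<le> 1/16" for n by (rule good(2))
  qed (simp_all add: good(1) init step)
  then show ?thesis by blast
qed

theorem theorem1p5:
  shows "\<exists>F :: nat \<Rightarrow> C2 \<Rightarrow> C2.
           (\<forall>n. holomorphic_automorphism (F n) \<and> attracting_fixed_point_at_0 (F n)) \<and>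
           short_C2 (nonautonomous_basin F) \<and> smooth_boundary (nonautonomous_basin F)"
proof -
  obtain a P G where "fast_henon_sequence a P G" using fast_henon_sequence_exists by blast
  then interpret fast_henon_sequence a P G .
  show ?thesis
    using F_automorphism F_attracting short_C2_basin basin_smooth_boundary by blast
qed

end
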